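(* Let $d=2$ or $d=3$. Then $d$ satisfies the vanishing condition: for each partition $\mathcal{P}$ of $\{1,\ldots,d\}$ and all $v_0,\ldots,v_d\in\mathbb{F}_2^d$ with $$\sum_{i=0}^d\alpha(\mathcal{P},v_i)<d+|\mathcal{P}|,$$ the intersection number $\mathrm{ldeg}\big(\prod_{i=0}^dF_{v_i}\big)$ vanishes.
   Context: For a partition $\mathcal{P}=\{P_1,\ldots,P_l\}$ of $\{1,\ldots,d\}$ and $v=(v_1,\ldots,v_d)\in\mathbb{F}_2^d$, set $\alpha(\mathcal{P},v):=\#\{i\in\{1,\ldots,l\}\mid\exists j\in P_i,\ v_j=1\}$; $|\mathcal P|=l$. For $d\ge1$, $\mathcal{C}(I^d)$ (the combinatorial Chow ring of the $d$-th power of the 1-simplex $I=\Delta[1]$) is the quotient of the graded polynomial ring $\mathbb{Z}[C_v\mid v\in\mathbb{F}_2^d]$ (generators of degree 1) by the ideal generated by: (1) $C_vC_w$ for all $v,w\in\mathbb{F}_2^d$ which are incomparable in the product order (where $0<1$ in each coordinate); (2) $\big(\sum_{w\in\mathbb{F}_2^d}C_w\big)C_v$ for all $v$; (3) $C_vC_{v'}\sum_{w\in\mathbb{F}_2^d,\ w_i=v_i}C_w$ for all $i\in\{1,\ldots,d\}$ and $v,v'$ with $v_i\neq v'_i$. Put $\mathcal{C}(I^d)_{\mathbb{Q}}=\mathcal{C}(I^d)\otimes_{\mathbb{Z}}\mathbb{Q}$. The local degree map $\mathrm{ldeg}:\mathcal{C}^{d+1}(I^d)\to\mathbb{Z}$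 (on the degree $d+1$ part, extended $\mathbb{Q}$-linearly) is the group homomorphism uniquely determined by $\mathrm{ldeg}(C_{v_0}C_{v_1}\cdots C_{v_d})=1$ for every strictly increasing chain $v_0<v_1<\cdots<v_d$ in the product order. (It is defined as the intersection-theoretic degree of products of components of the special fibre of the desingularization, by successively blowing up the strict transforms of the special-fibre components in lexicographic order, of $\bar L^d$, $\bar L=\mathrm{Proj}\,R[x_0,x_1,z]/(x_0x_1-\pi z^2)$, over a complete discrete valuation ring $R$ with uniformizer $\pi$ and algebraically closed residue field.) For $v\in\mathbb{F}_2^d$ put $F_v:=\sum_{w\in\mathbb{F}_2^d}(-1)^{\langle v,w\rangle}C_w$, where $\langle v,w\rangle=\sum_i v_iw_i\in\mathbb{F}_2$. *)

theory Defs
  imports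
    "HOL-Analysis.Finite_Cartesian_Product"
    "HOL-Library.Z2"
    "HOL-Library.Poly_Mapping"
    "HOL-Library.Disjoint_Sets"
    "HOL-Library.FuncSet"
begin

text \<open>
  The coordinates \<open>1, \<dots>, d\<close> are the elements of a finite type \<open>'n\<close>, so \<open>d = CARD('n)\<close>, and
  \<open>\<bbbF>\<^sub>2\<^sup>d\<close> is the type \<^typ>\<open>bit ^ 'n\<close>. With \<open>0 < 1\<close> in \<^typ>\<open>bit\<close>, the library's order on
  vectors is the product order.
\<close>

instantiation bit :: linorder
begin

definition less_eq_bit :: "bit \<Rightarrow> bit \<Rightarrow> bool"
  where "a \<le> b \<longleftrightarrow> (a = 1 \<longrightarrow> b = 1)" for a b :: bit

definition less_bit :: "bit \<Rightarrow> bit \<Rightarrow> bool"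
  where "a < b \<longleftrightarrow> a = 0 \<and> b = 1" for a b :: bit

instance
proof
  fix a b c :: bit
  show "a < b \<longleftrightarrow> a \<le> b \<and> \<not> b \<le> a"
    by (cases a; cases b) (auto simp: less_eq_bit_def less_bit_def)
  show "a \<le> a"
    by (simp add: less_eq_bit_def)
  show "a \<le> b \<Longrightarrow> b \<le> c \<Longrightarrow> a \<le> c"
    by (simp add: less_eq_bit_def)
  show "a \<le> b \<Longrightarrow> b \<le> a \<Longrightarrow> a = b"
    by (cases a; cases b) (auto simp: less_eq_bit_def)
  show "a \<le> b \<or> b \<le> a"
    by (auto simp: less_eq_bit_def)
qed

end

text \<open>The polynomial ring \<open>\<int>[C\<^sub>v | v \<in> \<bbbF>\<^sub>2\<^sup>d]\<close>; a monomial is its exponent function.\<close>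

type_synonym 'n cube_poly = "((bit ^ 'n) \<Rightarrow>\<^sub>0 nat) \<Rightarrow>\<^sub>0 int"

definition Var :: "bit ^ 'n \<Rightarrow> 'n::finite cube_poly"
  where "Var v = Poly_Mapping.single (Poly_Mapping.single v 1) 1"

definition homogeneous :: "nat \<Rightarrow> 'n::finite cube_poly \<Rightarrow> bool"
  where "homogeneous k p \<longleftrightarrow>
    (\<forall>m \<in> Poly_Mapping.keys p. (\<Sum>v\<in>UNIV. Poly_Mapping.lookup m v) = k)"

definition chow_relations :: "'n::finite cube_poly set"
  where "chow_relations =
    {Var v * Var w | v w. \<not> v \<le> w \<and> \<not> w \<le> v} \<union>
    {(\<Sum>w\<in>UNIV. Var w) * Var v | v. True} \<union>
    {Var v * Var v' * (\<Sum>w | w $ i = v $ i. Var w) | v v' i. v $ i \<noteq> v' $ i}"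

text \<open>The ideal generated by the relations is their span in the ring as a module over itself.\<close>

definition chow_ideal :: "'n::finite cube_poly set"
  where "chow_ideal = module.span (*) chow_relations"

lemma module_times: "module ((*) :: 'a::comm_ring_1 \<Rightarrow> 'a \<Rightarrow> 'a)"
  by standard (simp_all add: algebra_simps)

lemma chow_ideal_zero: "0 \<in> chow_ideal"
  unfolding chow_ideal_def by (rule module.span_zero[OF module_times])

lemma chow_ideal_add: "p \<in> chow_ideal \<Longrightarrow> q \<in> chow_ideal \<Longrightarrow> p + q \<in> chow_ideal"
  unfolding chow_ideal_def by (rule module.span_add[OF module_times])

lemma chow_ideal_mult: "q \<in> chow_ideal \<Longrightarrow> p * q \<in> chow_ideal"
  unfolding chow_ideal_def by (rule module.span_scale[OF module_times])

lemma chow_ideal_uminus: "p \<in> chow_ideal \<Longrightarrow> - p \<in> chow_ideal"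
  using chow_ideal_mult[of p "- 1"] by simp

lemma lookup_times_zero:
  fixes p q :: "('a \<Rightarrow>\<^sub>0 nat) \<Rightarrow>\<^sub>0 int"
  shows "Poly_Mapping.lookup (p * q) 0 = Poly_Mapping.lookup p 0 * Poly_Mapping.lookup q 0"
proof -
  have *: "(0 = l + r) = (l = 0 \<and> r = 0)" for l r :: "'a \<Rightarrow>\<^sub>0 nat"
    by (auto simp: poly_mapping_eq_iff lookup_add fun_eq_iff)
  have "Sum_any (\<lambda>r. Poly_Mapping.lookup q r when 0 = l + r) =
      (Poly_Mapping.lookup q 0 when l = 0)" for l
    by (cases "l = 0") (simp_all add: *)
  then show ?thesis
    by (simp add: lookup_mult mult_when)
qed

lemma lookup_Var_zero: "Poly_Mapping.lookup (Var v) 0 = 0"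
proof -
  have "Poly_Mapping.lookup (Poly_Mapping.single v (1::nat)) v \<noteq> Poly_Mapping.lookup 0 v"
    by simp
  then have "Poly_Mapping.single v (1::nat) \<noteq> 0"
    by metis
  then show ?thesis
    by (simp add: Var_def lookup_single)
qed

lemma chow_ideal_lookup_zero: "p \<in> chow_ideal \<Longrightarrow> Poly_Mapping.lookup p 0 = 0"
  unfolding chow_ideal_def
  by (erule module.span_induct_alt[OF module_times, consumes 1])
    (auto simp: chow_relations_def lookup_add lookup_times_zero lookup_Var_zero)

definition chow_rel :: "'n::finite cube_poly \<Rightarrow> 'n cube_poly \<Rightarrow> bool"
  where "chow_rel p q \<longleftrightarrow> p - q \<in> chow_ideal"

lemma equivp_chow_rel: "equivp (chow_rel :: 'n::finite cube_poly \<Rightarrow> _)"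
proof (rule equivpI)
  show "reflp (chow_rel :: 'n cube_poly \<Rightarrow> _)"
    by (simp add: reflp_def chow_rel_def chow_ideal_zero)
  show "symp (chow_rel :: 'n cube_poly \<Rightarrow> _)"
    unfolding symp_def chow_rel_def using chow_ideal_uminus by fastforce
  show "transp (chow_rel :: 'n cube_poly \<Rightarrow> _)"
    unfolding transp_def chow_rel_def
  proof (intro allI impI)
    fix p q r :: "'n cube_poly"
    assume "p - q \<in> chow_ideal" "q - r \<in> chow_ideal"
    then have "(p - q) + (q - r) \<in> chow_ideal"
      by (rule chow_ideal_add)
    then show "p - r \<in> chow_ideal"
      by simp
  qed
qed

quotient_type (overloaded) 'n chow = "'n::finite cube_poly" / chow_rel
  by (rule equivp_chow_rel)

instantiation chow :: (finite) comm_ring_1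
begin

lift_definition zero_chow :: "'a chow" is 0 .

lift_definition one_chow :: "'a chow" is 1 .

lift_definition plus_chow :: "'a chow \<Rightarrow> 'a chow \<Rightarrow> 'a chow" is "(+)"
proof -
  fix p p' q q' :: "'a cube_poly"
  assume "chow_rel p p'" "chow_rel q q'"
  then have "(p - p') + (q - q') \<in> chow_ideal"
    unfolding chow_rel_def by (rule chow_ideal_add)
  then show "chow_rel (p + q) (p' + q')"
    by (simp add: chow_rel_def algebra_simps)
qed

lift_definition uminus_chow :: "'a chow \<Rightarrow> 'a chow" is uminus
proof -
  fix p p' :: "'a cube_poly"
  assume "chow_rel p p'"
  then have "- (p - p') \<in> chow_ideal"
    unfolding chow_rel_def by (rule chow_ideal_uminus)
  then show "chow_rel (- p) (- p')"
    by (simp add: chow_rel_def)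
qed

lift_definition minus_chow :: "'a chow \<Rightarrow> 'a chow \<Rightarrow> 'a chow" is "(-)"
proof -
  fix p p' q q' :: "'a cube_poly"
  assume "chow_rel p p'" "chow_rel q q'"
  then have "(p - p') + - (q - q') \<in> chow_ideal"
    unfolding chow_rel_def by (intro chow_ideal_add chow_ideal_uminus)
  then show "chow_rel (p - q) (p' - q')"
    by (simp add: chow_rel_def algebra_simps)
qed

lift_definition times_chow :: "'a chow \<Rightarrow> 'a chow \<Rightarrow> 'a chow" is "(*)"
proof -
  fix p p' q q' :: "'a cube_poly"
  assume "chow_rel p p'" "chow_rel q q'"
  then have "q * (p - p') + p' * (q - q') \<in> chow_ideal"
    unfolding chow_rel_def by (intro chow_ideal_add chow_ideal_mult)
  then show "chow_rel (p * q) (p' * q')"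
    by (simp add: chow_rel_def algebra_simps)
qed

instance
proof
  fix a b c :: "'a chow"
  note eq = equivp_reflp[OF equivp_chow_rel]
  show "a * b * c = a * (b * c)"
    by transfer (simp add: mult.assoc eq)
  show "a * b = b * a"
    by transfer (simp add: mult.commute eq)
  show "1 * a = a"
    by transfer (simp add: eq)
  show "a + b + c = a + (b + c)"
    by transfer (simp add: add.assoc eq)
  show "a + b = b + a"
    by transfer (simp add: add.commute eq)
  show "0 + a = a"
    by transfer (simp add: eq)
  show "- a + a = 0"
    by transfer (simp add: eq)
  show "a - b = a + - b"
    by transfer (simp add: eq)
  show "(a + b) * c = a * c + b * c"
    by transfer (simp add: distrib_right eq)
  show "(0::'a chow) \<noteq> 1"
    by transfer (auto simp: chow_rel_def dest!: chow_ideal_lookup_zero)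
qed

end

lift_definition C :: "bit ^ 'n \<Rightarrow> 'n::finite chow" is Var .

definition chow_part :: "nat \<Rightarrow> 'n::finite chow set"
  where "chow_part k = abs_chow ` {p. homogeneous k p}"

text \<open>
  The homomorphism \<open>ldeg\<close> lives on the part of degree \<open>d + 1\<close> only; extensionality fixes its
  (irrelevant) values elsewhere, so that it is unique as a HOL function. Its values are integers:
  the rational extension agrees with it on the integral classes, in particular on products of
  the \<open>F\<^sub>v\<close> below.
\<close>

definition ldeg :: "'n::finite chow \<Rightarrow> int"
  where "ldeg = (THE f.
    f \<in> extensional (chow_part (CARD('n) + 1)) \<and>
    (\<forall>x \<in> chow_part (CARD('n) + 1). \<forall>y \<in> chow_part (CARD('n) + 1). f (x + y) = f x + f y) \<and>
    (\<forall>c :: nat \<Rightarrow> bit ^ 'n. strict_mono_on {0..CARD('n)} c \<longrightarrow> f (\<Prod>i=0..CARD('n). C (c i)) = 1))"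

definition pairing :: "bit ^ 'n \<Rightarrow> bit ^ 'n \<Rightarrow> bit"
  where "pairing v w = (\<Sum>i\<in>UNIV. v $ i * w $ i)"

definition F :: "bit ^ 'n \<Rightarrow> 'n::finite chow"
  where "F v = (\<Sum>w\<in>UNIV. (if pairing v w = 1 then - 1 else 1) * C w)"

definition alpha :: "'n set set \<Rightarrow> bit ^ 'n \<Rightarrow> nat"
  where "alpha P v = card {B \<in> P. \<exists>j\<in>B. v $ j = 1}"

end

theory Submission
  imports Defs
begin

text \<open>
  The product of the \<open>F\<^sub>v\<close> already vanishes in the Chow ring. Write \<open>e\<^sub>i\<close> for the unit vectors and \<open>g\<close> for
  \<open>F\<close> of \<open>e\<^sub>i + e\<^sub>j\<close>. By relation (3), \<open>F\<close> of \<open>e\<^sub>i\<close> kills \<open>C\<^sub>v C\<^sub>w\<close> whenever \<open>v\<close> and \<open>w\<close> differ in the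
  \<open>i\<close>-th coordinate; together with relation (2) this makes its square kill every \<open>C\<^sub>v\<close>. The relations
  among the four sums of the \<open>C\<^sub>w\<close> with prescribed \<open>i\<close>-th and \<open>j\<close>-th coordinates similarly give
  \<open>g\<^sup>2 F(e\<^sub>i) = 0\<close>, \<open>g\<^sup>4 = 0\<close>, and express \<open>g\<^sup>3\<close> and \<open>g F(e\<^sub>i) F(e\<^sub>j)\<close> as multiples of a point class of the
  square, which is killed by \<open>F(e\<^sub>k)\<close>. For \<open>d \<le> 3\<close> the numerical condition leaves no other products.

  This suffices once \<open>ldeg\<close> is known to be additive, that is, to exist and to be unique. For uniqueness, the
  relations rewrite every monomial of degree \<open>d + 1\<close> in terms of maximal chains. For existence, an explicit
  product of binomial coefficients on multichains is shown to respect the relations by a telescoping sum.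
\<close>

subsection \<open>Products in the Chow ring\<close>

instance bit :: finite
proof
  have "(UNIV :: bit set) \<subseteq> {0, 1}"
    by (blast intro: bit.exhaust)
  then show "finite (UNIV :: bit set)"
    by (rule finite_subset) simp
qed

lemma bit_eq_0_or_1: "a = 0 \<or> a = 1" for a :: bit
  by (cases a) auto

lemma bit_neq_iff: "a \<noteq> b \<longleftrightarrow> (a = 0 \<and> b = 1) \<or> (a = 1 \<and> b = 0)" for a b :: bit
  by (cases a; cases b) auto

lemma C_mult_incomparable:
  assumes "\<not> v \<le> w" "\<not> w \<le> v"
  shows "C v * C w = 0"
proof -
  have "Var v * Var w \<in> chow_ideal"
    unfolding chow_ideal_def chow_relations_def
    by (intro module.span_base[OF module_times]) (use assms in blast)
  then show ?thesis
    by transfer (simp add: chow_rel_def)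
qed

lemma abs_chow_plus: "abs_chow (p + q) = abs_chow p + abs_chow q"
  by (simp add: plus_chow.abs_eq)

lemma abs_chow_times: "abs_chow (p * q) = abs_chow p * abs_chow q"
  by (simp add: times_chow.abs_eq)

lemma abs_chow_uminus: "abs_chow (- p) = - abs_chow p"
  by (simp add: uminus_chow.abs_eq)

lemma abs_chow_sum: "abs_chow (sum f A) = (\<Sum>x\<in>A. abs_chow (f x))"
  by (induction A rule: infinite_finite_induct) (simp_all add: abs_chow_plus flip: zero_chow.abs_eq)

lemma abs_chow_Var: "abs_chow (Var v) = C v"
  by (simp only: C.abs_eq)

lemma abs_chow_eq_0: "p \<in> chow_ideal \<Longrightarrow> abs_chow p = 0"
proof -
  assume "p \<in> chow_ideal"
  then have "abs_chow p = abs_chow 0"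
    by (simp add: chow.abs_eq_iff chow_rel_def)
  then show ?thesis
    by (simp only: zero_chow.abs_eq)
qed

lemma sum_C_mult_C: "(\<Sum>w\<in>UNIV. C w) * C v = 0"
proof -
  have "(\<Sum>w\<in>UNIV. Var w) * Var v \<in> chow_ideal"
    unfolding chow_ideal_def chow_relations_def
    by (intro module.span_base[OF module_times]) blast
  from abs_chow_eq_0[OF this] show ?thesis
    by (simp only: abs_chow_times abs_chow_sum abs_chow_Var)
qed

lemma C_mult_C_mult_sum:
  assumes "v $ i \<noteq> v' $ i"
  shows "C v * C v' * (\<Sum>w | w $ i = v $ i. C w) = 0"
proof -
  have "Var v * Var v' * (\<Sum>w | w $ i = v $ i. Var w) \<in> chow_ideal"
    unfolding chow_ideal_def chow_relations_def
    by (intro module.span_base[OF module_times]) (use assms in blast)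
  from abs_chow_eq_0[OF this] show ?thesis
    by (simp only: abs_chow_times abs_chow_sum abs_chow_Var)
qed

section \<open>Class sums and multiplication by \<open>F\<close> of a unit vector\<close>

definition class_sum :: "(bit ^ 'n) set \<Rightarrow> 'n::finite chow"
  where "class_sum Q = (\<Sum>w\<in>Q. C w)"

lemma class_sum_Un: "Q \<inter> R = {} \<Longrightarrow> class_sum (Q \<union> R) = class_sum Q + class_sum R"
  unfolding class_sum_def by (intro sum.union_disjoint) auto

lemma class_sum_UNIV_mult: "class_sum UNIV * class_sum Q = 0"
  unfolding class_sum_def sum_distrib_left[of _ C Q] by (simp only: sum_C_mult_C sum.neutral_const)

lemma class_sum_mult_incomparable:
  assumes "\<And>v w. v \<in> Q \<Longrightarrow> w \<in> R \<Longrightarrow> \<not> v \<le> w \<and> \<not> w \<le> v"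
  shows "class_sum Q * class_sum R = 0"
  unfolding class_sum_def sum_product by (intro sum.neutral ballI C_mult_incomparable) (simp_all add: assms)

lemma class_sum_split: "class_sum Q = class_sum {w \<in> Q. w $ i = 0} + class_sum {w \<in> Q. w $ i = 1}"
proof -
  have "Q = {w \<in> Q. w $ i = 0} \<union> {w \<in> Q. w $ i = 1}"
    using bit_eq_0_or_1 by blast
  then have "class_sum Q = class_sum ({w \<in> Q. w $ i = 0} \<union> {w \<in> Q. w $ i = 1})"
    by (rule arg_cong)
  also have "\<dots> = class_sum {w \<in> Q. w $ i = 0} + class_sum {w \<in> Q. w $ i = 1}"
    by (rule class_sum_Un) auto
  finally show ?thesis .
qed

lemma class_sum_halves: "class_sum {w. w $ i = 0} + class_sum {w. w $ i = 1} = class_sum UNIV"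
  using class_sum_split[of UNIV i] by simp

lemma F_eq_class_sum: "F u = class_sum {w. pairing u w = 0} - class_sum {w. pairing u w = 1}"
proof -
  have "F u = (\<Sum>w\<in>{w. pairing u w = 0} \<union> {w. pairing u w = 1}.
      (if pairing u w = 1 then - 1 else 1) * C w)"
    unfolding F_def by (intro sum.cong) auto
  also have "\<dots> = (\<Sum>w | pairing u w = 0. C w) + (\<Sum>w | pairing u w = 1. - C w)"
    by (subst sum.union_disjoint) auto
  finally show ?thesis
    by (simp add: class_sum_def sum_negf)
qed

lemma pairing_axis: "pairing (axis i 1) w = w $ i"
proof -
  have "pairing (axis i 1) w = (\<Sum>j\<in>UNIV. if j = i then w $ i else 0)"
    unfolding pairing_def by (intro sum.cong) (auto simp: axis_def)
  then show ?thesis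
    by (simp only: sum.delta finite UNIV_I if_True)
qed

lemma pairing_add: "pairing (u + v) w = pairing u w + pairing v w"
  by (simp only: pairing_def vector_add_component distrib_right sum.distrib)

lemma F_zero: "F 0 = class_sum UNIV"
  by (simp add: F_def pairing_def class_sum_def)

lemma F_axis: "F (axis i 1) = class_sum {w. w $ i = 0} - class_sum {w. w $ i = 1}"
  by (simp add: F_eq_class_sum pairing_axis)

text \<open>Relation (3), used for a pair of vectors in both orders, shows that each half of the
  cube cut out by the \<open>i\<close>-th coordinate kills \<open>C v * C w\<close>. The element
  \<open>F (axis i 1)\<close> is the difference of these halves.\<close>

lemma F_axis_mult:
  assumes "\<And>v w. v \<in> Q \<Longrightarrow> w \<in> R \<Longrightarrow> v $ i \<noteq> w $ i"
  shows "F (axis i 1) * (class_sum Q * class_sum R) = 0"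
proof -
  have "F (axis i 1) * (C v * C w) = 0" if "v $ i \<noteq> w $ i" for v w :: "bit ^ 'a"
  proof -
    have v: "C v * C w * class_sum {x. x $ i = v $ i} = 0"
      unfolding class_sum_def by (rule C_mult_C_mult_sum[OF that])
    have w: "C v * C w * class_sum {x. x $ i = w $ i} = 0"
      unfolding class_sum_def mult.commute[of "C v"] by (rule C_mult_C_mult_sum[OF that[symmetric]])
    consider "v $ i = 0" "w $ i = 1" | "v $ i = 1" "w $ i = 0"
      using \<open>v $ i \<noteq> w $ i\<close> bit_neq_iff by blast
    then have "C v * C w * class_sum {x. x $ i = 0} = 0" "C v * C w * class_sum {x. x $ i = 1} = 0"
      using v w by (cases; simp)+
    then show ?thesis
      unfolding F_axis mult.commute[of _ "C v * C w"] by (simp add: right_diff_distrib)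
  qed
  with assms have "(\<Sum>v\<in>Q. \<Sum>w\<in>R. F (axis i 1) * (C v * C w)) = 0"
    by simp
  then show ?thesis
    unfolding class_sum_def sum_product by (simp only: sum_distrib_left)
qed

text \<open>On the part of \<open>Q\<close> with \<open>i\<close>-th coordinate 0, one factor is
  written as \<open>(?A + ?B) - 2 * ?B\<close>; on the other part, as
  \<open>2 * ?A - (?A + ?B)\<close>. The sum \<open>?A + ?B\<close> kills every class by relation
  (2), and in what remains two classes differ in coordinate \<open>i\<close>, so the second copy of
  \<open>?f\<close> kills their product.\<close>

lemma F_axis_square_mult_class_sum: "F (axis i 1) ^ 2 * class_sum Q = 0"
proof -
  let ?A = "class_sum {w :: bit ^ 'a. w $ i = 0}" and ?B = "class_sum {w :: bit ^ 'a. w $ i = 1}"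
  let ?f = "F (axis i 1) :: 'a chow"
  have f: "?f * (?f * x) = ?f * ((?A + ?B) * x) - 2 * (?f * (?B * x))"
    "?f * (?f * x) = 2 * (?f * (?A * x)) - ?f * ((?A + ?B) * x)" for x
    unfolding F_axis by (simp_all add: algebra_simps)
  have z: "(?A + ?B) * class_sum R = 0" for R
    unfolding class_sum_halves by (rule class_sum_UNIV_mult)
  have 0: "?f * (?B * class_sum {w \<in> Q. w $ i = 0}) = 0"
    by (rule F_axis_mult) simp
  have 1: "?f * (?A * class_sum {w \<in> Q. w $ i = 1}) = 0"
    by (rule F_axis_mult) simp
  show ?thesis
    unfolding class_sum_split[of Q i] distrib_left power2_eq_square mult.assoc
    unfolding f(1)[of "class_sum {w \<in> Q. w $ i = 0}"] f(2)[of "class_sum {w \<in> Q. w $ i = 1}"] z 0 1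
    by simp
qed

lemma F_zero_mult_F: "F 0 * F u = 0"
  by (simp only: F_zero F_eq_class_sum[of u] right_diff_distrib class_sum_UNIV_mult diff_self)

lemma F_axis_square_mult_F: "F (axis i 1) ^ 2 * F u = 0"
  by (simp only: F_eq_class_sum[of u] right_diff_distrib F_axis_square_mult_class_sum diff_self)

section \<open>Relations coming from two and three coordinates\<close>

text \<open>The elements \<open>p\<close>, \<open>q\<close>, \<open>r\<close>, \<open>s\<close>
  stand for the class sums over the quarters of the cube where the coordinates \<open>i\<close>,
  \<open>j\<close> are 00, 10, 01, 11. The relations determine the cubic monomials only after
  doubling, through identities such as \<open>z + f = 2 * (p + r)\<close>. This suffices because,
  modulo the relations, \<open>g ^ 2\<close> and \<open>f * h\<close> are multiples of 4.\<close>

lemma square_relations: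
  fixes p q r s :: "'a::comm_ring_1"
  defines "z \<equiv> p + q + r + s" and "f \<equiv> p + r - q - s" and "h \<equiv> p + q - r - s" and "g \<equiv> p + s - q - r"
  assumes z: "z * p = 0" "z * q = 0" "z * r = 0" "z * s = 0"
    and qr: "q * r = 0"
    and f: "f * (p * q) = 0" "f * (p * s) = 0" "f * (r * s) = 0"
    and h: "h * (p * r) = 0" "h * (p * s) = 0" "h * (q * s) = 0"
  shows "g ^ 2 * f = 0" "g ^ 4 = 0" "g ^ 3 = - 16 * (2 * (p * q * s))" "g * f * h = 8 * (2 * (p * q * s))"
proof -
  define t where "t = 2 * (p * q * s)"
  note defs = z_def f_def h_def g_def
  have "2 * (p * p * q) = z * p * q + f * (p * q) - 2 * p * (q * r)"
    "2 * (p * q * q) = z * p * q - f * (p * q) - t"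
    "2 * (p * r * s) = f * (p * s) - h * (p * s) + t"
    "2 * (q * s * s) = z * q * s - h * (q * s) - 2 * s * (q * r)"
    "2 * (q * q * s) = z * q * s + h * (q * s) - t"
    unfolding defs t_def by (simp_all add: algebra_simps)
  \<comment> \<open>Modulo the relations each of these doubled cubics is 0, \<open>t\<close> or
    \<open>- t\<close>. The third equation says that \<open>t\<close> does not change when
    \<open>q\<close> and \<open>r\<close>, that is, the two coordinates, are exchanged.\<close>
  then have 1: "2 * (p * p * q) = 0" "2 * (p * q * q) = - t" "2 * (p * r * s) = t"
    "2 * (q * s * s) = 0" "2 * (q * q * s) = - t"
    using z qr f h by simp_all
  have "2 * (p * p * r) = z * p * r + h * (p * r) - 2 * p * (q * r)"
    "2 * (p * r * r) = z * p * r - h * (p * r) - 2 * (p * r * s)"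
    "2 * (r * s * s) = z * r * s - f * (r * s) - 2 * s * (q * r)"
    "2 * (r * r * s) = z * r * s + f * (r * s) - 2 * (p * r * s)"
    "2 * (p * p * s) = z * p * s + f * (p * s) - 2 * (p * r * s)"
    "2 * (p * s * s) = z * p * s - f * (p * s) - t"
    unfolding defs t_def by (simp_all add: algebra_simps)
  then have 2: "2 * (p * p * r) = 0" "2 * (p * r * r) = - t" "2 * (r * s * s) = 0"
    "2 * (r * r * s) = - t" "2 * (p * p * s) = - t" "2 * (p * s * s) = - t"
    using z qr f h 1 by simp_all
  note cubic = 1 2
  \<comment> \<open>The elements \<open>z\<close> and \<open>g\<close> are the sum and the
    difference of \<open>p + s\<close> and \<open>q + r\<close>.\<close>
  have "g ^ 2 = z * p + z * q + z * r + z * s - 4 * ((p + s) * (q + r))"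
    unfolding defs by (simp add: algebra_simps power2_eq_square)
  then have g2: "g ^ 2 = - 4 * ((p + s) * (q + r))"
    using z by simp
  have "2 * ((p + s) * (q + r) * f) = 2 * (f * (p * q)) + 2 * (f * (r * s)) + 2 * (p * p * r)
      + 2 * (p * r * r) - 2 * (p * r * s) - 2 * p * (q * r) + t - 2 * (q * q * s)
      - 2 * (q * s * s) + 2 * s * (q * r)"
    unfolding defs t_def by (simp add: algebra_simps)
  then have "2 * ((p + s) * (q + r) * f) = 0"
    by (simp add: cubic f qr)
  moreover have "g ^ 2 * f = - 2 * (2 * ((p + s) * (q + r) * f))"
    unfolding g2 by (simp add: algebra_simps)
  ultimately show "g ^ 2 * f = 0"
    by simp
  have "2 * ((p + s) * (q + r) * g) = 2 * (p * p * q) + t - 2 * (p * q * q) + 2 * (p * p * r)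
      + 2 * (p * r * s) - 2 * (p * r * r) + t + 2 * (q * s * s) - 2 * (q * q * s) + 2 * (p * r * s)
      + 2 * (r * s * s) - 2 * (r * r * s) - 4 * (p + s) * (q * r)"
    unfolding defs t_def by (simp add: algebra_simps)
  then have "2 * ((p + s) * (q + r) * g) = 8 * t"
    by (simp add: cubic qr)
  moreover have "g ^ 2 * g = - 2 * (2 * ((p + s) * (q + r) * g))"
    unfolding g2 by (simp add: algebra_simps)
  ultimately have g3: "g ^ 2 * g = - 16 * t"
    by simp
  then show "g ^ 3 = - 16 * (2 * (p * q * s))"
    by (simp add: t_def power3_eq_cube power2_eq_square)
  have "t * s = p * (2 * (q * s * s))"
    unfolding t_def by (simp add: algebra_simps)
  then have "t * s = 0"
    by (simp add: cubic)
  moreover have "t * g = (2 * (p * p * q)) * s + t * s - 2 * (p * q * q) * s - 2 * p * s * (q * r)"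
    unfolding t_def defs by (simp add: algebra_simps)
  ultimately have "t * g = 0"
    by (simp add: cubic qr)
  moreover have "g ^ 4 = g ^ 2 * g * g"
    by (simp add: power4_eq_xxxx power2_eq_square)
  ultimately show "g ^ 4 = 0"
    unfolding g3 by (simp add: mult.assoc)
  have "f * h = z * p + z * s - z * q - z * r + 4 * (q * r) - 4 * (p * s)"
    unfolding defs by (simp add: algebra_simps)
  then have fh: "f * h = - 4 * (p * s)"
    by (simp add: z qr)
  have "g * f * h = g * (f * h)"
    by (simp add: mult.assoc)
  also have "\<dots> = - 2 * (2 * (p * p * s) + 2 * (p * s * s) - t - 2 * (p * r * s))"
    unfolding fh unfolding t_def defs by (simp add: algebra_simps)
  finally show "g * f * h = 8 * (2 * (p * q * s))"
    by (simp add: cubic flip: t_def)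
qed

lemma bit_add_eq_0_iff: "a + b = 0 \<longleftrightarrow> a = b" for a b :: bit
  by (cases a; cases b) auto

lemma bit_add_eq_1_iff: "a + b = 1 \<longleftrightarrow> a \<noteq> b" for a b :: bit
  by (cases a; cases b) auto

text \<open>The abstract relations are applied to the four quarters. Their hypotheses come from
  relation (2) in \<open>z0\<close>, relation (1) in \<open>qr\<close>, and relation (3) in
  \<open>f0\<close> and \<open>h0\<close>.\<close>

lemma axis_pair_relations:
  fixes i j :: "'n::finite"
  defines "X \<equiv> \<lambda>a b. class_sum {w :: bit ^ 'n. w $ i = a \<and> w $ j = b}"
    and "g \<equiv> F (axis i 1 + axis j 1)"
  shows "g ^ 2 * F (axis i 1) = 0" "g ^ 4 = 0" "g ^ 3 = - 16 * (2 * (X 0 0 * X 1 0 * X 1 1))"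
    "g * F (axis i 1) * F (axis j 1) = 8 * (2 * (X 0 0 * X 1 0 * X 1 1))"
proof -
  have split: "class_sum Q = class_sum {w \<in> Q. w $ i = 0 \<and> w $ j = 0} + class_sum {w \<in> Q. w $ i = 1 \<and> w $ j = 0}
      + class_sum {w \<in> Q. w $ i = 0 \<and> w $ j = 1} + class_sum {w \<in> Q. w $ i = 1 \<and> w $ j = 1}" for Q
    using class_sum_split[of Q i] class_sum_split[of "{w \<in> Q. w $ i = 0}" j] class_sum_split[of "{w \<in> Q. w $ i = 1}" j]
    by (simp add: ac_simps conj_ac)
  have z: "class_sum UNIV = X 0 0 + X 1 0 + X 0 1 + X 1 1"
    using split[of UNIV] by (simp add: X_def)
  have f: "F (axis i 1) = X 0 0 + X 0 1 - X 1 0 - X 1 1"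
    using class_sum_split[of "{w. w $ i = 0}" j] class_sum_split[of "{w. w $ i = 1}" j]
    by (simp add: F_axis X_def)
  have h: "F (axis j 1) = X 0 0 + X 1 0 - X 0 1 - X 1 1"
    using class_sum_split[of "{w. w $ j = 0}" i] class_sum_split[of "{w. w $ j = 1}" i]
    by (simp add: F_axis X_def conj_ac)
  have eq0: "{w. pairing (axis i 1 + axis j 1) w = 0} = {w. w $ i = w $ j}"
    by (simp only: pairing_add pairing_axis bit_add_eq_0_iff bit_add_eq_1_iff)
  have eq1: "{w. pairing (axis i 1 + axis j 1) w = 1} = {w. w $ i \<noteq> w $ j}"
    by (simp only: pairing_add pairing_axis bit_add_eq_0_iff bit_add_eq_1_iff)
  have g: "g = X 0 0 + X 1 1 - X 1 0 - X 0 1"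
  proof -
    have "class_sum {w. w $ i = w $ j} = X 0 0 + X 1 1"
      unfolding class_sum_split[of "{w. w $ i = w $ j}" i] X_def
      by (auto intro!: arg_cong2[where f = "(+)"] arg_cong[where f = class_sum])
    moreover have "class_sum {w. w $ i \<noteq> w $ j} = X 0 1 + X 1 0"
      unfolding class_sum_split[of "{w. w $ i \<noteq> w $ j}" i] X_def
      by (auto intro!: arg_cong2[where f = "(+)"] arg_cong[where f = class_sum])
    ultimately show ?thesis
      unfolding g_def F_eq_class_sum eq0 eq1 by simp
  qed
  have z0: "(X 0 0 + X 1 0 + X 0 1 + X 1 1) * X a b = 0" for a b
    unfolding z[symmetric] by (simp add: X_def class_sum_UNIV_mult)
  have qr: "X 1 0 * X 0 1 = 0"
    unfolding X_def by (rule class_sum_mult_incomparable) (auto simp: less_eq_vec_def less_eq_bit_def)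
  have f0: "(X 0 0 + X 0 1 - X 1 0 - X 1 1) * (X a b * X c d) = 0" if "a \<noteq> c" for a b c d
    unfolding f[symmetric] unfolding X_def by (rule F_axis_mult) (use that in auto)
  have h0: "(X 0 0 + X 1 0 - X 0 1 - X 1 1) * (X a b * X c d) = 0" if "b \<noteq> d" for a b c d
    unfolding h[symmetric] unfolding X_def by (rule F_axis_mult) (use that in auto)
  show "g ^ 2 * F (axis i 1) = 0" "g ^ 4 = 0" "g ^ 3 = - 16 * (2 * (X 0 0 * X 1 0 * X 1 1))"
    "g * F (axis i 1) * F (axis j 1) = 8 * (2 * (X 0 0 * X 1 0 * X 1 1))"
    unfolding g f h by (rule square_relations; (rule z0 qr f0 h0; simp))+
qed


text \<open>The third coordinate splits each quarter into two layers, such as \<open>p0\<close> and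
  \<open>p1\<close>. Of the eight resulting triple products only the two that lie in a single layer
  survive multiplication by \<open>f k\<close>. They turn into -2 and 2 times products along maximal
  chains in the coordinates \<open>i\<close>, \<open>j\<close>, \<open>k\<close>, and these products
  agree after doubling.\<close>

lemma point_mult_F_axis:
  fixes i j k :: "'n::finite"
  defines "X \<equiv> \<lambda>a b. class_sum {w :: bit ^ 'n. w $ i = a \<and> w $ j = b}"
  shows "X 0 0 * X 1 0 * X 1 1 * F (axis k 1) = 0"
proof -
  define Z where "Z = (\<lambda>a b c. class_sum {w :: bit ^ 'n. w $ i = a \<and> w $ j = b \<and> w $ k = c})"
  define f where "f l = F (axis l 1 :: bit ^ 'n)" for l
  define p0 p1 q0 q1 r0 r1 s0 s1 where defs: "p0 = Z 0 0 0" "p1 = Z 0 0 1" "q0 = Z 1 0 0"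
    "q1 = Z 1 0 1" "r0 = Z 0 1 0" "r1 = Z 0 1 1" "s0 = Z 1 1 0" "s1 = Z 1 1 1"
  have X: "X a b = Z a b 0 + Z a b 1" for a b
    using class_sum_split[of "{w. w $ i = a \<and> w $ j = b}" k] by (simp add: X_def Z_def conj_ac)
  have half: "class_sum {w. w $ i = a} = X a 0 + X a 1" "class_sum {w. w $ j = a} = X 0 a + X 1 a" for a
    using class_sum_split[of "{w. w $ i = a}" j] class_sum_split[of "{w. w $ j = a}" i]
    by (simp_all add: X_def conj_ac)
  have half': "class_sum {w. w $ k = a} = Z 0 0 a + Z 0 1 a + Z 1 0 a + Z 1 1 a" for a
    using class_sum_split[of "{w. w $ k = a}" i] class_sum_split[of "{w. w $ k = a \<and> w $ i = 0}" j]
      class_sum_split[of "{w. w $ k = a \<and> w $ i = 1}" j]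
    by (simp add: Z_def conj_ac)
  have f: "f i = p0 + p1 + r0 + r1 - q0 - q1 - s0 - s1"
    "f j = p0 + p1 + q0 + q1 - r0 - r1 - s0 - s1"
    "f k = p0 + q0 + r0 + s0 - p1 - q1 - r1 - s1"
    unfolding f_def F_axis half half' X defs by simp_all
  have kill: "f l * (class_sum Q * class_sum R) = 0" if "\<And>v w. v \<in> Q \<Longrightarrow> w \<in> R \<Longrightarrow> v $ l \<noteq> w $ l" for l Q R
    unfolding f_def by (rule F_axis_mult) (rule that)
  have k0: "f k * (p0 * s1) = 0" "f k * (p0 * q1) = 0" "f k * (p1 * q0) = 0" "f k * (p1 * s0) = 0"
    "f k * (q0 * s1) = 0" "f i * (p0 * q1) = 0" "f j * (q0 * s1) = 0"
    unfolding defs Z_def by (rule kill; simp)+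
  have incomparable: "Z a b c * Z a' b' c' = 0"
    if "\<not> (a \<le> a' \<and> b \<le> b' \<and> c \<le> c')" "\<not> (a' \<le> a \<and> b' \<le> b \<and> c' \<le> c)" for a b c a' b' c'
    unfolding Z_def by (rule class_sum_mult_incomparable) (use that in \<open>auto simp: less_eq_vec_def\<close>)
  have i0: "q0 * p1 = 0" "q1 * s0 = 0" "r1 * q0 = 0" "r0 * p1 = 0" "r1 * q1 = 0" "r0 * q0 = 0"
    unfolding defs by (rule incomparable; simp add: less_eq_bit_def)+
  have z: "(p0 + p1 + q0 + q1 + r0 + r1 + s0 + s1) * class_sum Q = 0" for Q
  proof -
    have "p0 + p1 + q0 + q1 + r0 + r1 + s0 + s1 = class_sum UNIV"
      unfolding class_sum_halves[of k, symmetric] half' defs by (simp add: ac_simps)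
    then show ?thesis
      by (simp add: class_sum_UNIV_mult)
  qed
  have z0: "(p0 + p1 + q0 + q1 + r0 + r1 + s0 + s1) * p0 = 0"
    and z1: "(p0 + p1 + q0 + q1 + r0 + r1 + s0 + s1) * p1 = 0"
    using z unfolding Z_def defs(1)[symmetric] by (simp_all only: defs(1,2) Z_def)
  \<comment> \<open>The element \<open>f k\<close> is the full sum minus twice the upper layer. In
    that layer all classes but \<open>s1\<close> are incomparable with \<open>q0\<close> or
    \<open>s0\<close>.\<close>
  have "f k * (p0 * q0 * s0) = (p0 + p1 + q0 + q1 + r0 + r1 + s0 + s1) * p0 * (q0 * s0)
      - 2 * (q0 * p1 * (p0 * s0) + q1 * s0 * (p0 * q0) + r1 * q0 * (p0 * s0) + p0 * q0 * s0 * s1)"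
    unfolding f by (simp add: algebra_simps)
  then have low: "f k * (p0 * q0 * s0) = - 2 * (p0 * q0 * s0 * s1)"
    unfolding z0 i0 by simp
  have "f k * (p1 * q1 * s1) = 2 * (p0 * p1 * q1 * s1 + q0 * p1 * (q1 * s1) + r0 * p1 * (q1 * s1)
      + q1 * s0 * (p1 * s1)) - (p0 + p1 + q0 + q1 + r0 + r1 + s0 + s1) * p1 * (q1 * s1)"
    unfolding f by (simp add: algebra_simps)
  then have high: "f k * (p1 * q1 * s1) = 2 * (p0 * p1 * q1 * s1)"
    unfolding z1 i0 by simp
  \<comment> \<open>The two chains are joined through \<open>p0 * q0 * q1 * s1\<close>, exchanging
    one element at a time: \<open>f i - f k\<close> replaces \<open>p1\<close> by \<open>q0\<close>,
    then \<open>f j - f k\<close> replaces \<open>q1\<close> by \<open>s0\<close>.\<close>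
  have "2 * (p0 * p1 * q1 * s1) - 2 * (p0 * q0 * q1 * s1) = f i * (p0 * q1) * s1 - f k * (p0 * q1) * s1
      - 2 * (r1 * q1 * (p0 * s1)) + 2 * (q1 * s0 * (p0 * s1))"
    "2 * (p0 * q0 * q1 * s1) - 2 * (p0 * q0 * s0 * s1) = f j * (q0 * s1) * p0 - f k * (q0 * s1) * p0
      - 2 * (q0 * p1 * (p0 * s1)) + 2 * (r0 * q0 * (p0 * s1))"
    unfolding f by (simp_all add: algebra_simps)
  then have chains: "2 * (p0 * p1 * q1 * s1) = 2 * (p0 * q0 * s0 * s1)"
    unfolding k0 i0 by simp
  have "X 0 0 * X 1 0 * X 1 1 * F (axis k 1) = f k * (p0 * q0 * s0) + f k * (p1 * q1 * s1)
      + f k * (p0 * s1) * q0 + f k * (p0 * q1) * (s0 + s1) + f k * (p1 * q0) * (s0 + s1)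
      + f k * (p1 * s0) * q1"
    unfolding X f_def[symmetric] defs[symmetric] by (simp add: algebra_simps)
  then show ?thesis
    unfolding k0 low high chains by simp
qed

text \<open>Here \<open>a\<close>, \<open>b\<close>, \<open>c\<close> stand for \<open>F\<close> of
  unit vectors and \<open>g\<close> for \<open>F\<close> of the sum of the first two. A quartic
  monomial not divisible by the square of \<open>a\<close>, \<open>b\<close> or \<open>c\<close> is
  divisible by \<open>g ^ 2 * a\<close> or \<open>g ^ 2 * b\<close>, or it is \<open>g ^ 4\<close>,
  \<open>g ^ 3 * c\<close> or \<open>g * a * b * c\<close>.\<close>

lemma product_of_four_eq_0:
  fixes a b c g :: "'a::comm_ring_1"
  assumes "\<And>x. x \<in> {a, b, c, g} \<Longrightarrow> a ^ 2 * x = 0" "\<And>x. x \<in> {a, b, c, g} \<Longrightarrow> b ^ 2 * x = 0"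
    "\<And>x. x \<in> {a, b, c, g} \<Longrightarrow> c ^ 2 * x = 0"
    and "g ^ 2 * a = 0" "g ^ 2 * b = 0" "g ^ 3 * c = 0" "g ^ 4 = 0" "g * a * b * c = 0"
    and "x0 \<in> {a, b, c, g}" "x1 \<in> {a, b, c, g}" "x2 \<in> {a, b, c, g}" "x3 \<in> {a, b, c, g}"
  shows "x0 * x1 * x2 * x3 = 0"
proof -
  have a: "a ^ 2 * a = 0" "a ^ 2 * b = 0" "a ^ 2 * c = 0" "a ^ 2 * g = 0"
    and b: "b ^ 2 * a = 0" "b ^ 2 * b = 0" "b ^ 2 * c = 0" "b ^ 2 * g = 0"
    and c: "c ^ 2 * a = 0" "c ^ 2 * b = 0" "c ^ 2 * c = 0" "c ^ 2 * g = 0"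
    using assms by auto
  have sq1: "y * (y * (x * u)) = 0" and sq2: "x * (y * (y * u)) = 0" if "y ^ 2 * x = 0" for x y u :: 'a
  proof -
    have "y * (y * (x * u)) = y ^ 2 * x * u" "x * (y * (y * u)) = y ^ 2 * x * u"
      by (simp_all add: power2_eq_square mult_ac)
    with that show "y * (y * (x * u)) = 0" "x * (y * (y * u)) = 0"
      by simp_all
  qed
  have 1: "a * (a * (a * u)) = 0" "a * (a * (b * u)) = 0" "a * (a * (c * u)) = 0" "a * (a * (g * u)) = 0"
    "b * (b * (b * u)) = 0" "b * (b * (c * u)) = 0" "b * (b * (g * u)) = 0"
    "a * (b * (b * u)) = 0" "c * (c * (c * u)) = 0" "c * (c * (g * u)) = 0"
    "a * (c * (c * u)) = 0" "b * (c * (c * u)) = 0" "a * (g * (g * u)) = 0" "b * (g * (g * u)) = 0" for u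
    by (rule sq1 sq2; fact)+
  have 2: "a * (b * (c * c)) = 0" "g * (g * (g * g)) = 0" "a * (b * (g * g)) = 0" "a * (c * (g * g)) = 0"
    "b * (c * (g * g)) = 0" "c * (g * (g * g)) = 0" "a * (b * (c * g)) = 0"
  proof -
    show "a * (b * (c * c)) = 0" "a * (b * (g * g)) = 0"
      using c(2) assms(5) by (simp_all add: power2_eq_square mult_ac)
    show "b * (c * (g * g)) = 0"
      using arg_cong[OF assms(5), of "(*) c"] by (simp add: power2_eq_square mult_ac)
    show "a * (c * (g * g)) = 0"
      using arg_cong[OF assms(4), of "(*) c"] by (simp add: power2_eq_square mult_ac)
    show "g * (g * (g * g)) = 0" "c * (g * (g * g)) = 0" "a * (b * (c * g)) = 0"
      using assms(6-8) by (simp_all add: power3_eq_cube power4_eq_xxxx mult_ac)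
  qed
  \<comment> \<open>Sorting the factors with \<open>mult_ac\<close> brings each of the 256 choices
    into the form of an equation in \<open>1\<close> or \<open>2\<close>.\<close>
  show ?thesis
    using assms(9-12) by (elim insertE emptyE; simp only: mult_ac 1 2)
qed

lemma F_product_eq_0:
  fixes i j k :: "'n::finite" and v :: "nat \<Rightarrow> bit ^ 'n"
  assumes "\<And>l. l \<le> 3 \<Longrightarrow> v l \<in> {axis i 1, axis j 1, axis k 1, axis i 1 + axis j 1}"
  shows "(\<Prod>l=0..3. F (v l)) = 0"
proof -
  let ?g = "axis i 1 + axis j 1 :: bit ^ 'n"
  let ?S = "{F (axis i 1), F (axis j 1), F (axis k 1), F ?g} :: 'n chow set"
  note pair = axis_pair_relations[of i j]
  have g1: "F ?g ^ 2 * F (axis j 1) = 0"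
    using axis_pair_relations(1)[of j i] by (simp add: add.commute)
  have g2: "F ?g ^ 3 * F (axis k 1) = 0"
    unfolding pair(3) using point_mult_F_axis[of i j k] by (simp add: mult.assoc)
  have g3: "F ?g * F (axis i 1) * F (axis j 1) * F (axis k 1) = 0"
    unfolding pair(4) using point_mult_F_axis[of i j k] by (simp add: mult.assoc)
  have sq: "F (axis l 1) ^ 2 * x = 0" if "x \<in> ?S" for l x
  proof -
    from that obtain u where "x = F u" by blast
    then show ?thesis by (simp only: F_axis_square_mult_F)
  qed
  have S: "F (v l) \<in> ?S" if "l \<le> 3" for l
    using imageI[OF assms[OF that], of F] by (simp only: image_insert image_empty)
  have "F (v 0) * F (v 1) * F (v 2) * F (v 3) = 0"
    by (rule product_of_four_eq_0[OF sq sq sq pair(1) g1 g2 pair(2) g3 S S S S]) simp_all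
  then show ?thesis
    by (simp add: numeral_eq_Suc mult_ac)
qed

subsection \<open>A weight function on multichains\<close>

definition ones :: "bit ^ 'n \<Rightarrow> 'n set"
  where "ones v = {i. v $ i = 1}"

definition level :: "bit ^ 'n::finite \<Rightarrow> nat"
  where "level v = card (ones v)"

lemma ones_le_iff: "v \<le> w \<longleftrightarrow> ones v \<subseteq> ones w"
  by (auto simp: less_eq_vec_def less_eq_bit_def ones_def)

lemma ones_inject: "ones v = ones w \<longleftrightarrow> v = w"
  using ones_le_iff[of v w] ones_le_iff[of w v] by (auto intro: antisym)

lemma ones_less_iff: "v < w \<longleftrightarrow> ones v \<subset> ones w"
  by (simp add: less_le_not_le ones_le_iff psubset_eq)

lemma level_strict_mono: "v < w \<Longrightarrow> level v < level w"
  by (simp add: level_def ones_less_iff psubset_card_mono)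

lemma level_le: "level v \<le> CARD('n)" for v :: "bit ^ 'n::finite"
  by (simp add: level_def card_mono)

lemma ones_of_set: "ones (\<chi> i. if i \<in> B then 1 else 0) = B"
  by (auto simp: ones_def)

text \<open>Through \<open>ones\<close>, the interval from \<open>u\<close> to \<open>v\<close> is
  the Boolean lattice on \<open>ones v - ones u\<close>, and the level above \<open>u\<close>
  becomes the size of a subset.\<close>

lemma card_interval_level:
  fixes u v :: "bit ^ 'n::finite"
  assumes "u \<le> v"
  shows "card {w. u \<le> w \<and> w \<le> v \<and> level w = level u + j} = (level v - level u) choose j"
proof -
  have uv: "ones u \<subseteq> ones v"
    using assms by (simp add: ones_le_iff)
  let ?f = "\<lambda>w. ones w - ones u"
  have "bij_betw ?f {w. u \<le> w \<and> w \<le> v \<and> level w = level u + j}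
      {B. B \<subseteq> ones v - ones u \<and> card B = j}"
  proof (rule bij_betw_byWitness[where f' = "\<lambda>B. \<chi> i. if i \<in> B \<union> ones u then 1 else 0"])
    show "\<forall>w\<in>{w. u \<le> w \<and> w \<le> v \<and> level w = level u + j}.
        (\<chi> i. if i \<in> ?f w \<union> ones u then 1 else 0) = w"
      by (auto simp: ones_inject[symmetric] ones_of_set ones_le_iff simp del: Un_iff)
    show "\<forall>B\<in>{B. B \<subseteq> ones v - ones u \<and> card B = j}.
        ?f (\<chi> i. if i \<in> B \<union> ones u then 1 else 0) = B"
      by (auto simp: ones_of_set simp del: Un_iff)
    show "?f ` {w. u \<le> w \<and> w \<le> v \<and> level w = level u + j} \<subseteq> {B. B \<subseteq> ones v - ones u \<and> card B = j}"
      by (auto simp: ones_le_iff level_def card_Diff_subset)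
    show "(\<lambda>B. \<chi> i. if i \<in> B \<union> ones u then 1 else 0) ` {B. B \<subseteq> ones v - ones u \<and> card B = j}
        \<subseteq> {w. u \<le> w \<and> w \<le> v \<and> level w = level u + j}"
    proof safe
      fix B assume B: "B \<subseteq> ones v - ones u"
      let ?w = "(\<chi> i. if i \<in> B \<union> ones u then 1 else 0) :: bit ^ 'n"
      have w: "ones ?w = B \<union> ones u"
        by (rule ones_of_set)
      show "u \<le> ?w" "?w \<le> v"
        unfolding ones_le_iff w using B uv by auto
      show "level ?w = level u + card B"
        unfolding level_def w using B by (subst card_Un_disjoint) auto
    qed
  qed
  then have "card {w. u \<le> w \<and> w \<le> v \<and> level w = level u + j} = card {B. B \<subseteq> ones v - ones u \<and> card B = j}"
    by (rule bij_betw_same_card)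
  also have "\<dots> = card (ones v - ones u) choose j"
    by (simp add: n_subsets)
  finally show ?thesis
    by (simp add: level_def card_Diff_subset uv)
qed

lemma card_open_interval_level:
  fixes u v :: "bit ^ 'n::finite"
  assumes "u < v" "level u < a" "a < level v"
  shows "card {w. u < w \<and> w < v \<and> level w = a} = (level v - level u) choose (a - level u)"
proof -
  have "{w. u < w \<and> w < v \<and> level w = a} = {w. u \<le> w \<and> w \<le> v \<and> level w = level u + (a - level u)}"
    using assms by (auto simp: order_le_less)
  then show ?thesis
    using card_interval_level[of u v "a - level u"] assms by simp
qed

text \<open>Setting the \<open>i\<close>-th coordinate of \<open>u\<close> to 1 gives a vector
  \<open>u'\<close> one level higher. The vectors counted form level \<open>a\<close> of the
  interval from \<open>u'\<close> to \<open>v\<close>, so both entries of the binomial drop by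
  one.\<close>

lemma card_open_interval_level_coord:
  fixes u v :: "bit ^ 'n::finite"
  assumes "u < v" "u $ i = 0" "v $ i = 1" "level u < a" "a < level v"
  shows "card {w. u < w \<and> w < v \<and> w $ i = 1 \<and> level w = a} = (level v - level u - 1) choose (a - level u - 1)"
proof -
  define u' :: "bit ^ 'n" where "u' = (\<chi> l. if l \<in> insert i (ones u) then 1 else 0)"
  have ones: "ones u' = insert i (ones u)"
    unfolding u'_def by (rule ones_of_set)
  have level: "level u' = Suc (level u)"
    using assms(2) unfolding level_def ones by (subst card_insert_disjoint) (auto simp: ones_def)
  have "u' \<le> v"
    using assms(1,3) unfolding ones_le_iff ones ones_less_iff by (auto simp: ones_def)
  have le_iff: "u' \<le> w \<longleftrightarrow> u \<le> w \<and> w $ i = 1" for w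
    unfolding ones_le_iff ones by (auto simp: ones_def)
  have "{w. u < w \<and> w < v \<and> w $ i = 1 \<and> level w = a} = {w. u' \<le> w \<and> w \<le> v \<and> level w = level u' + (a - level u')}"
    using assms unfolding le_iff level by (auto simp: order_le_less)
  then show ?thesis
    using card_interval_level[OF \<open>u' \<le> v\<close>, of "a - level u'"] by (simp add: level)
qed

text \<open>With an integer lower index, differences of levels and partial degrees may become
  negative; the value is then 0 and Pascal's rule holds without side conditions.\<close>

definition ichoose :: "nat \<Rightarrow> int \<Rightarrow> int"
  where "ichoose n k = (if k < 0 then 0 else int (n choose nat k))"

lemma ichoose_neg: "k < 0 \<Longrightarrow> ichoose n k = 0"
  by (simp add: ichoose_def)

lemma ichoose_Suc: "ichoose (Suc n) k = ichoose n k + ichoose n (k - 1)"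
proof (cases "k \<le> 0")
  case True
  then show ?thesis by (auto simp: ichoose_def)
next
  case False
  then obtain m where "k = int (Suc m)"
    by (metis not_le zero_less_imp_eq_int gr0_implies_Suc)
  then show ?thesis by (simp add: ichoose_def nat_add_distrib)
qed

lemma ichoose_0: "ichoose 0 k = of_bool (k = 0)"
  by (auto simp: ichoose_def)

lemma ichoose_0_right: "ichoose n 0 = 1"
  by (simp add: ichoose_def)

lemma ichoose_of_nat: "ichoose n (int k) = int (n choose k)"
  by (simp add: ichoose_def)

lemma ichoose_self: "ichoose n (int n) = 1"
  by (simp add: ichoose_def)

lemma ichoose_eq_0: "k > int n \<Longrightarrow> ichoose n k = 0"
  by (simp add: ichoose_def binomial_eq_0)


text \<open>
  For a chain \<open>v\<^sub>0 < \<dots> < v\<^sub>k\<close> with multiplicities \<open>m\<^sub>0, \<dots>, m\<^sub>k\<close> and levels \<open>h\<^sub>0 < \<dots> < h\<^sub>k\<close>, let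
  \<open>a\<^sub>j = m\<^sub>0 + \<dots> + m\<^bsub>j-1\<^esub>\<close>. Up to sign, the degree of the monomial is the product of the binomials
  \<open>m\<^sub>j - 1\<close> over \<open>h\<^sub>j - a\<^sub>j\<close> and, for \<open>j > 0\<close>, \<open>h\<^sub>j - h\<^bsub>j-1\<^esub> - 1\<close> over \<open>a\<^sub>j - 1 - h\<^bsub>j-1\<^esub>\<close>. Geometrically, the stratum
  of the chain is a product of permutohedral varieties, one for each gap, and \<open>C\<close> of \<open>v\<^sub>j\<close> restricts to
  minus the sum of two psi classes on the adjacent factors, whose top intersections are binomials. Below, \<open>h\<close> is
  one more than the level of the preceding element, so that \<open>h = a = 0\<close> is the correct start.
\<close>

fun chain_weight :: "(bit ^ 'n::finite \<Rightarrow> nat) \<Rightarrow> nat \<Rightarrow> nat \<Rightarrow> (bit ^ 'n) list \<Rightarrow> int"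
  where
    "chain_weight m h a [] = of_bool (a = CARD('n) + 1)"
  | "chain_weight m h a (v # vs) =
      - ichoose (level v - h) (int a - int h) * ichoose (m v - 1) (int (level v) - int a)
        * chain_weight m (Suc (level v)) (a + m v) vs"

fun chain_insert :: "'a::order \<Rightarrow> 'a list \<Rightarrow> 'a list"
  where
    "chain_insert w [] = [w]"
  | "chain_insert w (v # vs) = (if w < v then w # v # vs else if w = v then v # vs else v # chain_insert w vs)"

lemma set_chain_insert: "set (chain_insert w vs) = insert w (set vs)"
  by (induction w vs rule: chain_insert.induct) auto

lemma sorted_chain_insert:
  "sorted_wrt (<) vs \<Longrightarrow> (\<And>v. v \<in> set vs \<Longrightarrow> w \<le> v \<or> v \<le> w) \<Longrightarrow> sorted_wrt (<) (chain_insert w vs)"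
proof (induction w vs rule: chain_insert.induct)
  case (2 w v vs)
  then have "sorted_wrt (<) (chain_insert w vs)" if "\<not> w \<le> v"
    using that by (auto simp: order_le_less)
  moreover have "w \<le> v \<or> v \<le> w"
    using 2(3)[of v] by simp
  ultimately show ?case
    using 2(2) by (auto simp: set_chain_insert order_le_less)
qed simp

section \<open>The weight after inserting one more factor\<close>

lemma chain_weight_cong:
  "(\<And>v. v \<in> set vs \<Longrightarrow> m v = m' v) \<Longrightarrow> chain_weight m h a vs = chain_weight m' h a vs"
  by (induction vs arbitrary: h a) auto

definition incr :: "('a \<Rightarrow> nat) \<Rightarrow> 'a \<Rightarrow> 'a \<Rightarrow> nat"
  where "incr m w = m(w := Suc (m w))"

text \<open>The inclusion \<open>V \<subseteq> comparable V\<close> expresses below that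
  \<open>V\<close> is a chain.\<close>

definition comparable :: "'a::order set \<Rightarrow> 'a set"
  where "comparable V = {w. \<forall>v\<in>V. w \<le> v \<or> v \<le> w}"

lemma comparable_Cons:
  assumes "sorted_wrt (<) (v # vs)"
  shows "comparable (set (v # vs)) = {w. w < v} \<union> insert v ({w. v < w} \<inter> comparable (set vs))"
proof -
  have v: "v < x" if "x \<in> set vs" for x
    using assms that by simp
  have "w \<le> x" if "w \<le> v" "x \<in> set vs" for w x
    using order.trans[OF that(1) less_imp_le[OF v[OF that(2)]]] .
  then show ?thesis
    by (auto simp: comparable_def less_imp_le)
qed

text \<open>The new element has multiplicity 1, so the upper index of its second binomial is 0. This
  forces \<open>level w = a\<close>, and then its first binomial is 1.\<close>

lemma chain_weight_chain_insert_below: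
  assumes "w < v" "\<forall>x\<in>set vs. v < x" "m w = 0" "level w \<ge> h"
  shows "chain_weight (incr m w) h a (chain_insert w (v # vs)) =
    (if level w = a \<and> a \<ge> h then - chain_weight m (Suc a) (Suc a) (v # vs) else 0)"
proof -
  have "chain_weight (incr m w) (Suc (level w)) (Suc a) (v # vs) = chain_weight m (Suc (level w)) (Suc a) (v # vs)"
    by (rule chain_weight_cong) (use assms in \<open>auto simp: incr_def\<close>)
  then show ?thesis
    using assms by (auto simp: incr_def ichoose_0 ichoose_self of_nat_diff[symmetric] simp del: of_nat_diff chain_weight.simps(2) simp: chain_weight.simps(2)[of _ _ _ w])
qed

lemma chain_weight_chain_insert_at:
  assumes "\<forall>x\<in>set vs. v < x"
  shows "chain_weight (incr m v) h a (chain_insert v (v # vs)) =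
    - ichoose (level v - h) (int a - int h) * ichoose (m v) (int (level v) - int a)
      * chain_weight m (Suc (level v)) (a + Suc (m v)) vs"
proof -
  have "chain_weight (incr m v) (Suc (level v)) (a + Suc (m v)) vs = chain_weight m (Suc (level v)) (a + Suc (m v)) vs"
    by (rule chain_weight_cong) (use assms in \<open>auto simp: incr_def\<close>)
  then show ?thesis
    by (simp add: incr_def)
qed

lemma chain_weight_chain_insert_above:
  assumes "v < w"
  shows "chain_weight (incr m w) h a (chain_insert w (v # vs)) =
    - ichoose (level v - h) (int a - int h) * ichoose (m v - 1) (int (level v) - int a)
      * chain_weight (incr m w) (Suc (level v)) (a + m v) (chain_insert w vs)"
  using assms by (auto simp: incr_def)

text \<open>A summand is 0 unless \<open>w\<close> has level \<open>a\<close>, and otherwise it does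
  not depend on \<open>w\<close>. The sum thus reduces to counting one level of the gap below
  \<open>v\<close>.\<close>

lemma sum_gap:
  assumes "\<And>w. w \<in> W \<Longrightarrow> w < v \<and> h \<le> level w \<and> m w = 0" "h \<le> a" "\<forall>x\<in>set vs. v < x"
  shows "(\<Sum>w\<in>W. chain_weight (incr m w) h a (chain_insert w (v # vs))) =
    int (card {w \<in> W. level w = a})
      * (ichoose (m v - 1) (int (level v) - int (Suc a)) * chain_weight m (Suc (level v)) (Suc a + m v) vs)"
    (is "_ = _ * ?c")
proof -
  have "(\<Sum>w\<in>W. chain_weight (incr m w) h a (chain_insert w (v # vs))) = (\<Sum>w\<in>W. if level w = a then ?c else 0)"
    by (rule sum.cong[OF refl], subst chain_weight_chain_insert_below) (use assms in \<open>auto simp: ichoose_0_right\<close>)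
  also have "\<dots> = (\<Sum>w\<in>{w \<in> W. level w = a}. ?c)"
    by (rule sum.inter_filter[symmetric]) simp
  finally show ?thesis
    by simp
qed

lemma sum_below_un_above:
  fixes f :: "bit ^ 'n::finite \<Rightarrow> int"
  assumes "X \<subseteq> {w. w < v}"
  shows "sum f (X \<union> insert v ({w. v < w} \<inter> Y)) = sum f X + sum f (insert v ({w. v < w} \<inter> Y))"
proof (rule sum.union_disjoint)
  have "w \<noteq> v \<and> \<not> v < w" if "w \<in> X" for w
    using assms that less_asym by (metis less_irrefl mem_Collect_eq subsetD)
  then show "X \<inter> insert v ({w. v < w} \<inter> Y) = {}"
    by blast
qed simp_all

text \<open>If \<open>Suc (level v) \<le> a + m v\<close> fails, the lower index
  \<open>level v - a\<close> exceeds \<open>m v - 1\<close> and the prefactor vanishes. Hence the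
  inner sum may be evaluated under this inequality, which is the invariant of the inductions
  below.\<close>

lemma sum_above_skip:
  assumes "0 < m v" "W \<subseteq> {w. v < w}"
    and "Suc (level v) \<le> a + m v \<Longrightarrow>
      (\<Sum>w\<in>W. chain_weight (incr m w) (Suc (level v)) (a + m v) (chain_insert w vs)) = s"
  shows "(\<Sum>w\<in>W. chain_weight (incr m w) h a (chain_insert w (v # vs))) =
    - ichoose (level v - h) (int a - int h) * ichoose (m v - 1) (int (level v) - int a) * s"
proof -
  let ?K = "- ichoose (level v - h) (int a - int h) * ichoose (m v - 1) (int (level v) - int a)"
  have "(\<Sum>w\<in>W. chain_weight (incr m w) h a (chain_insert w (v # vs))) =
      (\<Sum>w\<in>W. ?K * chain_weight (incr m w) (Suc (level v)) (a + m v) (chain_insert w vs))"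
    by (rule sum.cong[OF refl], rule chain_weight_chain_insert_above) (use assms in auto)
  also have "\<dots> = ?K * (\<Sum>w\<in>W. chain_weight (incr m w) (Suc (level v)) (a + m v) (chain_insert w vs))"
    by (rule sum_distrib_left[symmetric])
  also have "\<dots> = ?K * s"
  proof (cases "Suc (level v) \<le> a + m v")
    case True
    then show ?thesis
      by (simp add: assms(3))
  next
    case False
    then have "ichoose (m v - 1) (int (level v) - int a) = 0"
      using assms(1) by (intro ichoose_eq_0) simp
    then show ?thesis
      by simp
  qed
  finally show ?thesis .
qed

text \<open>Raising the multiplicity of \<open>v\<close> produces a binomial with upper index
  \<open>m v\<close>; inserting above \<open>v\<close> produces one with upper index
  \<open>m v - 1\<close> and the opposite sign. By Pascal's rule they combine to a binomial whose
  lower index is smaller by one.\<close>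

lemma sum_at_and_above:
  assumes "0 < m v" "\<forall>x\<in>set vs. v < x"
    and "Suc (level v) \<le> a + m v \<Longrightarrow>
      (\<Sum>w\<in>{w. v < w} \<inter> comparable (set vs). chain_weight (incr m w) (Suc (level v)) (a + m v) (chain_insert w vs)) =
        - chain_weight m (Suc (level v)) (Suc (a + m v)) vs"
  shows "(\<Sum>w\<in>insert v ({w. v < w} \<inter> comparable (set vs)). chain_weight (incr m w) h a (chain_insert w (v # vs))) =
    - ichoose (level v - h) (int a - int h) * ichoose (m v - 1) (int (level v) - int (Suc a))
      * chain_weight m (Suc (level v)) (Suc a + m v) vs"
proof -
  let ?W = "{w. v < w} \<inter> comparable (set vs)"
  let ?g = "ichoose (level v - h) (int a - int h)" and ?q = "int (level v) - int a"
    and ?val = "chain_weight m (Suc (level v)) (Suc (a + m v)) vs"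
  have above: "(\<Sum>w\<in>?W. chain_weight (incr m w) h a (chain_insert w (v # vs))) = ?g * ichoose (m v - 1) ?q * ?val"
    by (subst sum_above_skip[where s = "- ?val"]) (use assms in auto)
  have "ichoose (m v) ?q = ichoose (m v - 1) ?q + ichoose (m v - 1) (?q - 1)"
    using ichoose_Suc[of "m v - 1" ?q] assms(1) by simp
  then show ?thesis
    using assms(2) above
    by (subst sum.insert) (simp_all only: chain_weight_chain_insert_at, simp_all add: algebra_simps)
qed

text \<open>
  The contributions of \<open>w\<close> inside a gap, at a chain element, and above it cancel in pairs by Pascal's
  rule, which leaves only the boundary term.
\<close>

lemma sum_chain_weight_above:
  fixes u :: "bit ^ 'n::finite"
  assumes "sorted_wrt (<) (u # vs)" "\<And>w. u < w \<Longrightarrow> 0 < m w \<longleftrightarrow> w \<in> set vs" "Suc (level u) \<le> a"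
  shows "(\<Sum>w\<in>{w. u < w} \<inter> comparable (set vs). chain_weight (incr m w) (Suc (level u)) a (chain_insert w vs)) =
    - chain_weight m (Suc (level u)) (Suc a) vs"
  using assms
proof (induction vs arbitrary: u a)
  case Nil
  let ?t = "(\<chi> i. 1) :: bit ^ 'n"
  have top: "level w = CARD('n) \<longleftrightarrow> w = ?t" for w :: "bit ^ 'n"
  proof -
    have "ones ?t = UNIV"
      by (simp add: ones_def)
    moreover have "level w = CARD('n) \<longleftrightarrow> ones w = UNIV"
      unfolding level_def by (metis card_eq_UNIV_imp_eq_UNIV finite)
    ultimately show ?thesis
      using ones_inject by metis
  qed
  have t: "u < ?t" if "level u < CARD('n)"
  proof -
    have "u \<le> ?t" "u \<noteq> ?t"
      using that top[of u] by (auto simp: less_eq_vec_def less_eq_bit_def)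
    then show ?thesis by simp
  qed
  have m: "m w = 0" if "u < w" for w
    using Nil.prems(2)[OF that] by simp
  \<comment> \<open>Beyond the last chain element, the second binomial of an inserted
    \<open>w\<close> forces \<open>level w = a\<close> and the final weight forces
    \<open>a = CARD('n)\<close>. Only the top vertex \<open>?t\<close> can contribute.\<close>
  have "(\<Sum>w\<in>{w. u < w} \<inter> comparable (set []). chain_weight (incr m w) (Suc (level u)) a (chain_insert w [])) =
      (\<Sum>w\<in>{w. u < w}. if w = ?t then - of_bool (a = CARD('n)) else 0)"
  proof (rule sum.cong)
    fix w assume "w \<in> {w. u < w}"
    then have w: "u < w" "level u < level w" "m w = 0"
      using m level_strict_mono by auto
    have "ichoose (level w - Suc (level u)) (int (level w) - int (Suc (level u))) = 1"
      using w ichoose_self[of "level w - Suc (level u)"] by simp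
    then show "chain_weight (incr m w) (Suc (level u)) a (chain_insert w []) = (if w = ?t then - of_bool (a = CARD('n)) else 0)"
      using w(3) top[of w] by (auto simp: incr_def ichoose_0)
  qed (simp add: comparable_def)
  \<comment> \<open>If \<open>u\<close> is already the top vertex, the sum is empty, and
    \<open>a > CARD('n)\<close> makes the right-hand side 0 as well.\<close>
  also have "\<dots> = - chain_weight m (Suc (level u)) (Suc a) []"
    using t Nil.prems(3) level_le[of u] by (auto simp: sum.delta)
  finally show ?case .
next
  case (Cons v vs)
  have uv: "u < v" and v: "\<forall>x\<in>set vs. v < x" and vs: "sorted_wrt (<) (v # vs)"
    using Cons.prems(1) by auto
  have mv: "0 < m v"
    using Cons.prems(2)[OF uv] by simp
  have "level u < level v"
    using level_strict_mono[OF uv] .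
  let ?f = "\<lambda>w. chain_weight (incr m w) (Suc (level u)) a (chain_insert w (v # vs))"
  let ?b = "insert v ({w. v < w} \<inter> comparable (set vs))"
  let ?val = "ichoose (m v - 1) (int (level v) - int (Suc a)) * chain_weight m (Suc (level v)) (Suc a + m v) vs"
  have gap: "sum ?f {w. u < w \<and> w < v} = int (card {w \<in> {w. u < w \<and> w < v}. level w = a}) * ?val"
  proof (rule sum_gap[where m = m and v = v and vs = vs, OF _ Cons.prems(3) v])
    fix w assume "w \<in> {w. u < w \<and> w < v}"
    then have w: "u < w" "w < v" by auto
    have "w \<notin> set (v # vs)"
      using w v by (metis less_asym set_ConsD)
    then show "w < v \<and> Suc (level u) \<le> level w \<and> m w = 0"
      using w(2) Cons.prems(2)[OF w(1)] level_strict_mono[OF w(1)] by linarith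
  qed
  \<comment> \<open>For \<open>a = level v\<close> the open interval has no element of level
    \<open>a\<close>, while the binomial is 1. Multiplication by \<open>?val\<close> restores
    equality: its binomial has a negative lower index as soon as
    \<open>a \<ge> level v\<close>.\<close>
  have card: "int (card {w \<in> {w. u < w \<and> w < v}. level w = a}) * ?val =
      ichoose (level v - level u) (int a - int (level u)) * ?val"
  proof (cases "a < level v")
    case True
    then show ?thesis
      using card_open_interval_level[OF uv _ True] Cons.prems(3)
      by (simp add: ichoose_def conj_ac nat_diff_distrib)
  next
    case False
    then have "ichoose (m v - 1) (int (level v) - int (Suc a)) = 0"
      by (intro ichoose_neg) simp
    then show ?thesis
      by simp
  qed
  have ge: "sum ?f ?b = - ichoose (level v - Suc (level u)) (int a - int (Suc (level u))) * ?val"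
    unfolding mult.assoc[symmetric]
  proof (rule sum_at_and_above[where m = m and v = v and vs = vs, OF mv v])
    assume "Suc (level v) \<le> a + m v"
    then show "(\<Sum>w\<in>{w. v < w} \<inter> comparable (set vs). chain_weight (incr m w) (Suc (level v)) (a + m v) (chain_insert w vs)) =
        - chain_weight m (Suc (level v)) (Suc (a + m v)) vs"
    proof (intro Cons.IH[OF vs])
      fix w assume w: "v < w"
      then show "0 < m w \<longleftrightarrow> w \<in> set vs"
        using Cons.prems(2)[OF order.strict_trans[OF uv w]] by auto
    qed
  qed
  have "u < w" if "v < w" for w
    using order.strict_trans[OF uv that] .
  then have "{w. u < w} \<inter> comparable (set (v # vs)) = {w. u < w \<and> w < v} \<union> ?b"
    unfolding comparable_Cons[OF vs] using uv by (intro set_eqI) auto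
  then have "sum ?f ({w. u < w} \<inter> comparable (set (v # vs))) = sum ?f {w. u < w \<and> w < v} + sum ?f ?b"
    by (simp only:) (rule sum_below_un_above; blast)
  also have "\<dots> = (ichoose (level v - level u) (int a - int (level u))
      - ichoose (level v - Suc (level u)) (int a - int (Suc (level u)))) * ?val"
    unfolding gap card ge by (simp only: algebra_simps)
  \<comment> \<open>Pascal's rule turns the difference into the first binomial of the weight that
    starts from \<open>Suc a\<close>.\<close>
  also have "ichoose (level v - level u) (int a - int (level u))
      - ichoose (level v - Suc (level u)) (int a - int (Suc (level u))) =
      ichoose (level v - Suc (level u)) (int (Suc a) - int (Suc (level u)))"
    using ichoose_Suc[of "level v - Suc (level u)" "int a - int (level u)"] \<open>level u < level v\<close>
    by (simp add: Suc_diff_Suc algebra_simps)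
  finally show ?case
    by (simp add: algebra_simps)
qed


text \<open>This is relation (2) for weights. From the starting state only the zero vector can
  contribute below \<open>v\<close>, and it cancels the insertions at and above \<open>v\<close>. If
  \<open>v\<close> is itself the zero vector, both contributions vanish.\<close>

lemma sum_chain_weight_total:
  fixes v :: "bit ^ 'n::finite"
  assumes "sorted_wrt (<) (v # vs)" "\<And>w. 0 < m w \<longleftrightarrow> w \<in> set (v # vs)"
  shows "(\<Sum>w\<in>comparable (set (v # vs)). chain_weight (incr m w) 0 0 (chain_insert w (v # vs))) = 0"
proof -
  have v: "\<forall>x\<in>set vs. v < x"
    using assms(1) by simp
  let ?f = "\<lambda>w. chain_weight (incr m w) 0 0 (chain_insert w (v # vs))"
  let ?b = "insert v ({w. v < w} \<inter> comparable (set vs))"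
  let ?val = "ichoose (m v - 1) (int (level v) - int (Suc 0)) * chain_weight m (Suc (level v)) (Suc 0 + m v) vs"
  have gap: "sum ?f {w. w < v} = int (card {w \<in> {w. w < v}. level w = 0}) * ?val"
  proof (rule sum_gap[where m = m and v = v and vs = vs, OF _ _ v])
    fix w assume "w \<in> {w. w < v}"
    then have "w < v" by simp
    then have "w \<notin> set (v # vs)"
      using v \<open>w < v\<close> by (metis less_asym set_ConsD)
    with \<open>w < v\<close> show "w < v \<and> 0 \<le> level w \<and> m w = 0"
      using assms(2)[of w] by auto
  qed simp
  have card: "int (card {w \<in> {w. w < v}. level w = 0}) * ?val = ?val"
  proof (cases "level v = 0")
    case True
    then have "ichoose (m v - 1) (int (level v) - int (Suc 0)) = 0"
      by (intro ichoose_neg) simp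
    then show ?thesis
      by simp
  next
    case False
    have "level (0 :: bit ^ 'n) = 0" "0 \<le> w" for w :: "bit ^ 'n"
      by (simp_all add: level_def ones_def less_eq_vec_def less_eq_bit_def)
    then have "{w \<in> {w. w < v}. level w = 0} = {w. 0 \<le> w \<and> w \<le> v \<and> level w = level (0 :: bit ^ 'n) + 0}"
      using False by (auto simp: order_le_less)
    then show ?thesis
      using card_interval_level[of 0 v 0] \<open>0 \<le> v\<close> by simp
  qed
  have ge: "sum ?f ?b = - ichoose (level v - 0) (int 0 - int 0) * ?val"
    unfolding mult.assoc[symmetric]
    by (rule sum_at_and_above[where m = m and v = v and vs = vs, OF _ v]) (use assms(2) in \<open>auto intro!: sum_chain_weight_above[OF assms(1)]\<close>)
  have "sum ?f (comparable (set (v # vs))) = sum ?f {w. w < v} + sum ?f ?b"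
    unfolding comparable_Cons[OF assms(1)] by (rule sum_below_un_above) blast
  also have "\<dots> = 0"
    unfolding gap card ge by (simp add: ichoose_0_right)
  finally show ?thesis .
qed

text \<open>This is relation (3) for weights, on the side of coordinate 1. Chain elements with
  \<open>i\<close>-th coordinate 0 are skipped, as nothing at or below them is summed. At the first
  element \<open>v\<close> with coordinate 1, the number of admissible vectors in the gap is the
  very binomial that the insertions at and above \<open>v\<close> carry with a minus sign.\<close>

lemma sum_chain_weight_above_coord:
  fixes u :: "bit ^ 'n::finite"
  assumes "sorted_wrt (<) (u # vs)" "\<And>w. u < w \<Longrightarrow> 0 < m w \<longleftrightarrow> w \<in> set vs" "Suc (level u) \<le> a"
    and "u $ i = 0" "x \<in> set vs" "x $ i = 1"
  shows "(\<Sum>w\<in>{w. u < w \<and> w $ i = 1} \<inter> comparable (set vs).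
    chain_weight (incr m w) (Suc (level u)) a (chain_insert w vs)) = 0"
  using assms
proof (induction vs arbitrary: u a)
  case (Cons v vs)
  have uv: "u < v" and v: "\<forall>x\<in>set vs. v < x" and vs: "sorted_wrt (<) (v # vs)"
    using Cons.prems(1) by auto
  have mv: "0 < m v" and m: "\<And>w. v < w \<Longrightarrow> 0 < m w \<longleftrightarrow> w \<in> set vs"
    using Cons.prems(2)[OF uv] Cons.prems(2)[OF order.strict_trans[OF uv]] by auto
  have uw: "u < w" if "v < w" for w
    using order.strict_trans[OF uv that] .
  have coord_mono: "y $ i \<le> w $ i" if "y < w" for y w :: "bit ^ 'n"
    using that by (simp add: less_le_not_le less_eq_vec_def)
  let ?f = "\<lambda>w. chain_weight (incr m w) (Suc (level u)) a (chain_insert w (v # vs))"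
  show ?case
  proof (cases "v $ i = 1")
    case True
    let ?b = "insert v ({w. v < w} \<inter> comparable (set vs))"
    let ?W = "{w. u < w \<and> w < v \<and> w $ i = 1}"
    let ?val = "ichoose (m v - 1) (int (level v) - int (Suc a)) * chain_weight m (Suc (level v)) (Suc a + m v) vs"
    have gap: "sum ?f ?W = int (card {w \<in> ?W. level w = a}) * ?val"
    proof (rule sum_gap[where m = m and v = v and vs = vs, OF _ Cons.prems(3) v])
      fix w assume "w \<in> ?W"
      then have w: "u < w" "w < v" by auto
      have "w \<notin> set (v # vs)"
        using w v by (metis less_asym set_ConsD)
      then show "w < v \<and> Suc (level u) \<le> level w \<and> m w = 0"
        using w(2) Cons.prems(2)[OF w(1)] level_strict_mono[OF w(1)] by linarith
    qed
    have card: "int (card {w \<in> ?W. level w = a}) * ?val =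
        ichoose (level v - Suc (level u)) (int a - int (Suc (level u))) * ?val"
    proof (cases "a < level v")
      case a: True
      then show ?thesis
        using card_open_interval_level_coord[OF uv Cons.prems(4) True _ a] Cons.prems(3)
          ichoose_of_nat[of "level v - Suc (level u)" "a - Suc (level u)"]
        by (simp add: conj_ac of_nat_diff)
    next
      case False
      then have "ichoose (m v - 1) (int (level v) - int (Suc a)) = 0"
        by (intro ichoose_neg) simp
      then show ?thesis
        by simp
    qed
    have ge: "sum ?f ?b = - ichoose (level v - Suc (level u)) (int a - int (Suc (level u))) * ?val"
      unfolding mult.assoc[symmetric]
      by (rule sum_at_and_above[where m = m and v = v and vs = vs, OF mv v]) (rule sum_chain_weight_above[OF vs m])
    have "w $ i = 1" if "v < w" for w
      using coord_mono[OF that] True by (simp add: less_eq_bit_def)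
    then have "{w. u < w \<and> w $ i = 1} \<inter> comparable (set (v # vs)) = ?W \<union> ?b"
      unfolding comparable_Cons[OF vs] using uv uw True by (intro set_eqI) auto
    then have "sum ?f ({w. u < w \<and> w $ i = 1} \<inter> comparable (set (v # vs))) = sum ?f ?W + sum ?f ?b"
      by (simp only:) (rule sum_below_un_above; blast)
    then show ?thesis
      unfolding gap card ge by simp
  next
    case False
    then have v0: "v $ i = 0" and x: "x \<in> set vs"
      using Cons.prems(5,6) bit_eq_0_or_1 by auto
    have "w $ i = 0" if "w < v" for w
      using coord_mono[OF that] v0 by (simp add: less_eq_bit_def)
    then have "{w. u < w \<and> w $ i = 1} \<inter> comparable (set (v # vs)) = {w. v < w \<and> w $ i = 1} \<inter> comparable (set vs)"
      unfolding comparable_Cons[OF vs] using uw v0 by auto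
    then show ?thesis
      using Cons.IH[OF vs m _ v0 x Cons.prems(6)]
      by (simp only:) (subst sum_above_skip[where s = 0]; use mv in auto)
  qed
qed simp

lemma sum_chain_weight_coord:
  fixes v :: "bit ^ 'n::finite"
  assumes vs: "sorted_wrt (<) (v # vs)" and m: "\<And>w. 0 < m w \<longleftrightarrow> w \<in> set (v # vs)"
    and v0: "v $ i = 0" and x: "x \<in> set vs" "x $ i = 1"
  shows "(\<Sum>w\<in>{w. w $ i = 1} \<inter> comparable (set (v # vs)). chain_weight (incr m w) 0 0 (chain_insert w (v # vs))) = 0"
proof -
  have coord_mono: "y $ i \<le> w $ i" if "y < w" for y w :: "bit ^ 'n"
    using that by (simp add: less_le_not_le less_eq_vec_def)
  have "w $ i = 0" if "w < v" for w
    using coord_mono[OF that] v0 by (simp add: less_eq_bit_def)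
  then have eq: "{w. w $ i = 1} \<inter> comparable (set (v # vs)) = {w. v < w \<and> w $ i = 1} \<inter> comparable (set vs)"
    unfolding comparable_Cons[OF vs] using v0 by auto
  have "0 < m v" and m': "\<And>w. v < w \<Longrightarrow> 0 < m w \<longleftrightarrow> w \<in> set vs"
    using m by auto
  then show ?thesis
    unfolding eq
    using sum_chain_weight_above_coord[OF vs m' _ v0 x] \<open>0 < m v\<close>
    by (subst sum_above_skip[where s = 0]) auto
qed

subsection \<open>Existence of the local degree\<close>

lemma sorted_wrt_less_unique:
  fixes xs ys :: "'a::order list"
  assumes "sorted_wrt (<) xs" "sorted_wrt (<) ys" "set xs = set ys"
  shows "xs = ys"
  using assms
proof (induction xs arbitrary: ys)
  case (Cons x xs)
  then obtain y ys' where ys: "ys = y # ys'"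
    by (cases ys) auto
  have "x = y"
  proof (rule ccontr)
    assume "x \<noteq> y"
    moreover have "x \<in> set (y # ys')" "y \<in> set (x # xs)"
      using Cons.prems(3) ys by auto
    ultimately have "y < x" "x < y"
      using Cons.prems(1,2) ys by auto
    then show False
      by simp
  qed
  moreover have "x \<notin> set xs" "y \<notin> set ys'"
    using Cons.prems(1,2) ys by auto
  ultimately have "set xs = set ys'"
    using Cons.prems(3) ys by (metis insert_ident list.simps(15))
  then show ?case
    using Cons.IH[of ys'] Cons.prems(1,2) ys \<open>x = y\<close> by auto
qed simp

lemma sorted_list_of_chain:
  fixes V :: "'a::order set"
  assumes "finite V" "V \<subseteq> comparable V"
  obtains vs where "sorted_wrt (<) vs" "set vs = V"
proof -
  have "\<exists>vs. sorted_wrt (<) vs \<and> set vs = V"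
    using assms
  proof (induction V rule: finite_induct)
    case (insert x V)
    then obtain vs where vs: "sorted_wrt (<) vs" "set vs = V"
      by (auto simp: comparable_def)
    have "sorted_wrt (<) (chain_insert x vs)"
      using vs insert.prems by (intro sorted_chain_insert) (auto simp: comparable_def)
    then show ?case
      using vs set_chain_insert[of x vs] by auto
  qed simp
  then show thesis
    using that by blast
qed

lemma sorted_imp_chain:
  assumes "sorted_wrt (<) vs"
  shows "set vs \<subseteq> comparable (set vs)"
  using assms by (induction vs) (auto simp: comparable_def less_imp_le)

text \<open>Monomials whose support is not a chain get 0, in accordance with relation (1). The sign
  normalises maximal chains to weight 1, since each of their \<open>CARD('n) + 1\<close> elements
  contributes a factor -1.\<close>

definition monom_weight :: "(bit ^ 'n::finite \<Rightarrow>\<^sub>0 nat) \<Rightarrow> int"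
  where "monom_weight m =
    (if Poly_Mapping.keys m \<subseteq> comparable (Poly_Mapping.keys m)
     then (- 1) ^ (CARD('n) + 1) * chain_weight (Poly_Mapping.lookup m) 0 0
       (THE vs. sorted_wrt (<) vs \<and> set vs = Poly_Mapping.keys m)
     else 0)"

lemma monom_weight_eq:
  fixes m :: "bit ^ 'n::finite \<Rightarrow>\<^sub>0 nat"
  assumes "sorted_wrt (<) vs" "set vs = Poly_Mapping.keys m"
  shows "monom_weight m = (- 1) ^ (CARD('n) + 1) * chain_weight (Poly_Mapping.lookup m) 0 0 vs"
proof -
  have "(THE vs. sorted_wrt (<) vs \<and> set vs = Poly_Mapping.keys m) = vs"
  proof (rule the_equality)
    fix xs assume "sorted_wrt (<) xs \<and> set xs = Poly_Mapping.keys m"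
    then show "xs = vs"
      using assms by (intro sorted_wrt_less_unique) auto
  qed (use assms in simp)
  then show ?thesis
    using sorted_imp_chain[OF assms(1)] assms(2) by (simp add: monom_weight_def)
qed

lemma monom_weight_not_chain:
  "\<not> Poly_Mapping.keys m \<subseteq> comparable (Poly_Mapping.keys m) \<Longrightarrow> monom_weight m = 0"
  by (simp add: monom_weight_def)

lemma keys_plus_single: "Poly_Mapping.keys (m + Poly_Mapping.single w 1) = insert w (Poly_Mapping.keys m)"
  for m :: "'a \<Rightarrow>\<^sub>0 nat"
  by (auto simp: in_keys_iff lookup_add lookup_single when_def split: if_splits)

lemma monom_weight_plus_single:
  fixes m :: "bit ^ 'n::finite \<Rightarrow>\<^sub>0 nat"
  assumes "sorted_wrt (<) vs" "set vs = Poly_Mapping.keys m"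
  shows "monom_weight (m + Poly_Mapping.single w 1) =
    (if w \<in> comparable (set vs)
     then (- 1) ^ (CARD('n) + 1) * chain_weight (incr (Poly_Mapping.lookup m) w) 0 0 (chain_insert w vs) else 0)"
proof (cases "w \<in> comparable (set vs)")
  case True
  have "Poly_Mapping.lookup (m + Poly_Mapping.single w 1) = incr (Poly_Mapping.lookup m) w"
    by (auto simp: fun_eq_iff incr_def lookup_add lookup_single)
  moreover have "sorted_wrt (<) (chain_insert w vs)"
    using True assms(1) by (intro sorted_chain_insert) (auto simp: comparable_def)
  moreover have "set (chain_insert w vs) = Poly_Mapping.keys (m + Poly_Mapping.single w 1)"
    unfolding set_chain_insert keys_plus_single assms(2) ..
  ultimately show ?thesis
    using True monom_weight_eq[of "chain_insert w vs" "m + Poly_Mapping.single w 1"] by simp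
next
  case False
  then have "\<not> insert w (Poly_Mapping.keys m) \<subseteq> comparable (insert w (Poly_Mapping.keys m))"
    using assms(2) by (auto simp: comparable_def)
  then have "monom_weight (m + Poly_Mapping.single w 1) = 0"
    by (intro monom_weight_not_chain) (simp only: keys_plus_single not_False_eq_True)
  then show ?thesis
    using False by simp
qed

lemma sum_monom_weight:
  fixes m :: "bit ^ 'n::finite \<Rightarrow>\<^sub>0 nat"
  assumes "sorted_wrt (<) vs" "set vs = Poly_Mapping.keys m"
  shows "(\<Sum>w\<in>W. monom_weight (m + Poly_Mapping.single w 1)) =
    (- 1) ^ (CARD('n) + 1) *
      (\<Sum>w\<in>W \<inter> comparable (set vs). chain_weight (incr (Poly_Mapping.lookup m) w) 0 0 (chain_insert w vs))"
  unfolding monom_weight_plus_single[OF assms] sum_distrib_left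
  by (subst sum.inter_restrict) simp_all

lemma sum_monom_weight_not_chain:
  assumes "\<not> Poly_Mapping.keys m \<subseteq> comparable (Poly_Mapping.keys m)"
  shows "(\<Sum>w\<in>W. monom_weight (m + Poly_Mapping.single w 1)) = 0"
proof (rule sum.neutral, rule ballI)
  fix w
  have "\<not> insert w (Poly_Mapping.keys m) \<subseteq> comparable (insert w (Poly_Mapping.keys m))"
    using assms by (auto simp: comparable_def)
  then show "monom_weight (m + Poly_Mapping.single w 1) = 0"
    by (intro monom_weight_not_chain) (simp only: keys_plus_single not_False_eq_True)
qed

lemma sum_monom_weight_UNIV:
  fixes m :: "bit ^ 'n::finite \<Rightarrow>\<^sub>0 nat"
  assumes "v \<in> Poly_Mapping.keys m"
  shows "(\<Sum>w\<in>UNIV. monom_weight (m + Poly_Mapping.single w 1)) = 0"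
proof (cases "Poly_Mapping.keys m \<subseteq> comparable (Poly_Mapping.keys m)")
  case True
  then obtain vs where vs: "sorted_wrt (<) vs" "set vs = Poly_Mapping.keys m"
    using sorted_list_of_chain finite_keys by metis
  moreover from vs(2) assms obtain x xs where "vs = x # xs"
    by (cases vs) auto
  ultimately have "(\<Sum>w\<in>comparable (set vs). chain_weight (incr (Poly_Mapping.lookup m) w) 0 0 (chain_insert w vs)) = 0"
    using sum_chain_weight_total[of x xs "Poly_Mapping.lookup m"] by (auto simp: in_keys_iff)
  then show ?thesis
    by (simp only: sum_monom_weight[OF vs] Int_UNIV_left mult_zero_right)
qed (rule sum_monom_weight_not_chain)

text \<open>The minimum of the support lies below \<open>v\<close> and so has \<open>i\<close>-th
  coordinate 0; this gives the sum over coordinate 1. The sum over coordinate 0 is what remains of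
  the vanishing total.\<close>

lemma sum_monom_weight_coord:
  fixes m :: "bit ^ 'n::finite \<Rightarrow>\<^sub>0 nat"
  assumes "v \<in> Poly_Mapping.keys m" "v' \<in> Poly_Mapping.keys m" "v $ i = 0" "v' $ i = 1"
  shows "(\<Sum>w | w $ i = a. monom_weight (m + Poly_Mapping.single w 1)) = 0"
proof (cases "Poly_Mapping.keys m \<subseteq> comparable (Poly_Mapping.keys m)")
  case True
  then obtain vs where vs: "sorted_wrt (<) vs" "set vs = Poly_Mapping.keys m"
    using sorted_list_of_chain finite_keys by metis
  then obtain x xs where x: "vs = x # xs"
    using assms(1) by (cases vs) auto
  have "x \<le> v"
    using vs assms(1) unfolding x by (auto simp: less_imp_le)
  then have x0: "x $ i = 0"
    using assms(3) bit_eq_0_or_1[of "x $ i"] by (auto simp: less_eq_vec_def less_eq_bit_def)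
  then have "v' \<noteq> x"
    using assms(4) by auto
  then have "v' \<in> set xs"
    using vs(2) assms(2) unfolding x by auto
  then have "(\<Sum>w\<in>{w. w $ i = 1} \<inter> comparable (set vs). chain_weight (incr (Poly_Mapping.lookup m) w) 0 0 (chain_insert w vs)) = 0"
    using sum_chain_weight_coord[of x xs "Poly_Mapping.lookup m", OF _ _ x0 _ assms(4)] vs(1)
      in_keys_iff[of _ m, folded vs(2)]
    unfolding x by simp
  then have one: "(\<Sum>w | w $ i = 1. monom_weight (m + Poly_Mapping.single w 1)) = 0"
    by (simp only: sum_monom_weight[OF vs] mult_zero_right)
  have UNIV: "(UNIV :: (bit ^ 'n) set) = {w. w $ i = 0} \<union> {w. w $ i = 1}"
    using bit_eq_0_or_1 by auto
  have "(\<Sum>w\<in>UNIV. monom_weight (m + Poly_Mapping.single w 1)) =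
      (\<Sum>w | w $ i = 0. monom_weight (m + Poly_Mapping.single w 1)) +
      (\<Sum>w | w $ i = 1. monom_weight (m + Poly_Mapping.single w 1))"
    by (subst UNIV) (rule sum.union_disjoint; auto)
  then show ?thesis
    using one sum_monom_weight_UNIV[OF assms(1)] bit_eq_0_or_1[of a] by auto
qed (rule sum_monom_weight_not_chain)

section \<open>The degree functional on polynomials and on the Chow ring\<close>

definition deg_poly :: "'n::finite cube_poly \<Rightarrow> int"
  where "deg_poly p = (\<Sum>m\<in>Poly_Mapping.keys p. Poly_Mapping.lookup p m * monom_weight m)"

lemma deg_poly_add: "deg_poly (p + q) = deg_poly p + deg_poly q"
  unfolding deg_poly_def by (rule setsum_keys_plus_distrib) (simp_all add: distrib_right)

lemma deg_poly_0: "deg_poly 0 = 0"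
  by (simp add: deg_poly_def)

lemma deg_poly_sum: "deg_poly (sum f A) = (\<Sum>x\<in>A. deg_poly (f x))"
  by (induction A rule: infinite_finite_induct) (simp_all add: deg_poly_0 deg_poly_add)

lemma deg_poly_single: "deg_poly (Poly_Mapping.single m c) = c * monom_weight m"
  by (simp add: deg_poly_def)

lemma poly_eq_sum_single:
  fixes p :: "'a \<Rightarrow>\<^sub>0 'b::comm_monoid_add"
  shows "p = (\<Sum>m\<in>Poly_Mapping.keys p. Poly_Mapping.single m (Poly_Mapping.lookup p m))"
proof (rule poly_mapping_eqI)
  fix k
  have "(\<Sum>m\<in>Poly_Mapping.keys p. Poly_Mapping.lookup p m when m = k) = Poly_Mapping.lookup p k"
    by (simp add: when_def sum.delta in_keys_iff)
  then show "Poly_Mapping.lookup p k =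
      Poly_Mapping.lookup (\<Sum>m\<in>Poly_Mapping.keys p. Poly_Mapping.single m (Poly_Mapping.lookup p m)) k"
    by (simp add: lookup_sum lookup_single)
qed

lemma single_mult_Var:
  "Poly_Mapping.single m c * Var v = Poly_Mapping.single (m + Poly_Mapping.single v 1) c"
  by (simp add: Var_def mult_single)

lemma deg_poly_single_mult_sum:
  "deg_poly (Poly_Mapping.single m c * (\<Sum>w\<in>W. Var w)) =
    c * (\<Sum>w\<in>W. monom_weight (m + Poly_Mapping.single w 1))"
  by (simp only: sum_distrib_left single_mult_Var deg_poly_sum deg_poly_single)

lemma deg_poly_single_mult_relation:
  fixes r :: "'n::finite cube_poly"
  assumes "r \<in> chow_relations"
  shows "deg_poly (Poly_Mapping.single m c * r) = 0"
proof -
  let ?s = "\<lambda>v. Poly_Mapping.single v (1 :: nat)"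
  consider v w where "r = Var v * Var w" "\<not> v \<le> w" "\<not> w \<le> v"
    | v where "r = (\<Sum>w\<in>UNIV. Var w) * Var v"
    | v v' i where "r = Var v * Var v' * (\<Sum>w | w $ i = v $ i. Var w)" "v $ i \<noteq> v' $ i"
    using assms unfolding chow_relations_def by blast
  then show ?thesis
  proof cases
    case 1
    have "\<not> Poly_Mapping.keys (m + ?s v + ?s w) \<subseteq> comparable (Poly_Mapping.keys (m + ?s v + ?s w))"
      unfolding keys_plus_single using 1(2,3) by (auto simp: comparable_def)
    then have "monom_weight (m + ?s v + ?s w) = 0"
      by (rule monom_weight_not_chain)
    then show ?thesis
      unfolding 1(1) mult.assoc[symmetric] single_mult_Var deg_poly_single by (simp only: mult_zero_right)
  next
    case 2
    have v: "v \<in> Poly_Mapping.keys (m + ?s v)"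
      unfolding keys_plus_single by simp
    have "Poly_Mapping.single m c * r = Poly_Mapping.single (m + ?s v) c * (\<Sum>w\<in>UNIV. Var w)"
      unfolding 2 single_mult_Var[symmetric] by (simp only: mult_ac)
    then show ?thesis
      by (simp only: deg_poly_single_mult_sum sum_monom_weight_UNIV[OF v] mult_zero_right)
  next
    case 3
    have v: "v \<in> Poly_Mapping.keys (m + ?s v + ?s v')" "v' \<in> Poly_Mapping.keys (m + ?s v + ?s v')"
      unfolding keys_plus_single by simp_all
    have "(\<Sum>w | w $ i = v $ i. monom_weight (m + ?s v + ?s v' + ?s w)) = 0"
      using sum_monom_weight_coord[OF v] sum_monom_weight_coord[OF v(2,1)] 3(2) bit_neq_iff by blast
    then show ?thesis
      unfolding 3(1) mult.assoc[symmetric] single_mult_Var deg_poly_single_mult_sum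
      by (simp only: mult_zero_right)
  qed
qed

text \<open>An element of the ideal is a combination of relations with polynomial coefficients.
  Expanding each coefficient into monomials reduces the claim to monomial multiples of one
  relation.\<close>

lemma deg_poly_ideal:
  assumes "p \<in> chow_ideal"
  shows "deg_poly p = 0"
  using assms unfolding chow_ideal_def
proof (induction rule: module.span_induct_alt[OF module_times, consumes 1, case_names base step])
  case (step c x y)
  have "c * x = (\<Sum>m\<in>Poly_Mapping.keys c. Poly_Mapping.single m (Poly_Mapping.lookup c m) * x)"
    by (subst poly_eq_sum_single[of c]) (rule sum_distrib_right)
  then have "deg_poly (c * x) = 0"
    using deg_poly_single_mult_relation[OF step(1)] by (simp only: deg_poly_sum sum.neutral_const)
  with step(2) show ?case
    by (simp add: deg_poly_add)
qed (rule deg_poly_0)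

text \<open>The functional lives on the whole ring; the clause of \<open>chain_weight\<close> for
  the empty list makes it 0 on monomials of degree other than \<open>CARD('n) + 1\<close>.\<close>

lift_definition deg_chow :: "'n::finite chow \<Rightarrow> int" is deg_poly
proof -
  fix p q :: "'n cube_poly"
  assume "chow_rel p q"
  then have "deg_poly (p - q) = 0"
    by (simp add: chow_rel_def deg_poly_ideal)
  then show "deg_poly p = deg_poly q"
    using deg_poly_add[of "p - q" q] by simp
qed

lemma deg_chow_add: "deg_chow (x + y) = deg_chow x + deg_chow y"
  by transfer (rule deg_poly_add)

section \<open>Classes of monomials and degrees of maximal chains\<close>

definition monom_class :: "(bit ^ 'n \<Rightarrow>\<^sub>0 nat) \<Rightarrow> 'n::finite chow"
  where "monom_class m = abs_chow (Poly_Mapping.single m 1)"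

lemma monom_class_0: "monom_class 0 = 1"
  by (simp add: monom_class_def one_chow.abs_eq)

lemma monom_class_plus_single: "monom_class (m + Poly_Mapping.single v 1) = monom_class m * C v"
  by (simp only: monom_class_def flip: single_mult_Var abs_chow_Var abs_chow_times)

lemma monom_class_sum: "monom_class (\<Sum>i\<in>I. Poly_Mapping.single (c i) 1) = (\<Prod>i\<in>I. C (c i))"
proof (induction I rule: infinite_finite_induct)
  case (insert i I)
  have "monom_class (\<Sum>i\<in>insert i I. Poly_Mapping.single (c i) 1) =
      monom_class ((\<Sum>i\<in>I. Poly_Mapping.single (c i) 1) + Poly_Mapping.single (c i) 1)"
    unfolding sum.insert[OF insert.hyps] by (rule arg_cong[OF add.commute])
  also have "\<dots> = (\<Prod>i\<in>insert i I. C (c i))"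
    unfolding monom_class_plus_single prod.insert[OF insert.hyps] insert.IH by (rule mult.commute)
  finally show ?case .
qed (simp_all add: monom_class_0)

lemma deg_chow_monom_class: "deg_chow (monom_class m) = monom_weight m"
  by (simp add: monom_class_def deg_chow.abs_eq deg_poly_single)

text \<open>The \<open>CARD('n) + 1\<close> levels increase strictly within
  \<open>{0..CARD('n)}\<close>, which leaves no room for a jump.\<close>

lemma level_maximal_chain:
  fixes c :: "nat \<Rightarrow> bit ^ 'n::finite"
  assumes "strict_mono_on {0..CARD('n)} c" "i \<le> CARD('n)"
  shows "level (c i) = i"
proof -
  have step: "level (c i) + (j - i) \<le> level (c j)" if "i \<le> j" "j \<le> CARD('n)" for i j
    using that
  proof (induction j rule: dec_induct)
    case (step j)
    have "c j < c (Suc j)"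
      using assms(1) step.prems by (intro strict_mono_onD[OF assms(1)]) auto
    then show ?case
      using step level_strict_mono[of "c j" "c (Suc j)"] by simp
  qed simp
  show ?thesis
    using step[of 0 i] step[of i "CARD('n)"] level_le[of "c CARD('n)"] assms(2) by simp
qed

text \<open>Along a maximal chain the level, \<open>h\<close> and \<open>a\<close> agree at every
  element, so both binomials are 1 and only the signs remain.\<close>

lemma chain_weight_maximal_chain:
  fixes c :: "nat \<Rightarrow> bit ^ 'n::finite"
  assumes "\<And>i. i \<le> CARD('n) \<Longrightarrow> level (c i) = i \<and> m (c i) = 1" "i \<le> CARD('n) + 1"
  shows "chain_weight m i i (map c [i..<CARD('n) + 1]) = (- 1) ^ (CARD('n) + 1 - i)"
  using assms(2)
proof (induction i rule: inc_induct)
  case (step i)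
  then have "[i..<CARD('n) + 1] = i # [Suc i..<CARD('n) + 1]"
    by (intro upt_conv_Cons)
  then show ?case
    using assms(1)[of i] step by (simp add: ichoose_0_right Suc_diff_le del: upt_Suc)
qed simp

lemma deg_chow_maximal_chain:
  fixes c :: "nat \<Rightarrow> bit ^ 'n::finite"
  assumes "strict_mono_on {0..CARD('n)} c"
  shows "deg_chow (\<Prod>i=0..CARD('n). C (c i)) = 1"
proof -
  let ?I = "{0..CARD('n)}"
  let ?m = "\<Sum>i\<in>?I. Poly_Mapping.single (c i) (1::nat)"
  have inj: "inj_on c ?I"
    by (rule strict_mono_on_imp_inj_on[OF assms])
  have lookup: "Poly_Mapping.lookup ?m v = (\<Sum>i\<in>?I. if c i = v then 1 else 0)" for v
    by (simp only: lookup_sum lookup_single when_def)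
  have 1: "Poly_Mapping.lookup ?m (c i) = 1" if "i \<in> ?I" for i
  proof -
    have "Poly_Mapping.lookup ?m (c i) = (\<Sum>j\<in>?I. if j = i then 1 else 0)"
      unfolding lookup using inj_on_eq_iff[OF inj _ that] by (intro sum.cong) auto
    then show ?thesis
      using that by simp
  qed
  have "Poly_Mapping.lookup ?m v = 0" if "v \<notin> c ` ?I" for v
    unfolding lookup using that by (intro sum.neutral) auto
  then have keys: "Poly_Mapping.keys ?m = c ` ?I"
    using 1 by (auto simp: in_keys_iff)
  have sorted: "sorted_wrt (<) (map c [0..<CARD('n) + 1])"
    unfolding sorted_wrt_map
    by (rule sorted_wrt_mono_rel[OF _ sorted_wrt_upt]) (auto intro: strict_mono_onD[OF assms])
  have "monom_weight ?m = (- 1) ^ (CARD('n) + 1) * chain_weight (Poly_Mapping.lookup ?m) 0 0 (map c [0..<CARD('n) + 1])"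
    by (rule monom_weight_eq[OF sorted]) (simp only: keys set_map set_upt atLeastLessThanSuc_atLeastAtMost Suc_eq_plus1[symmetric])
  also have "\<dots> = (- 1) ^ (CARD('n) + 1) * (- 1) ^ (CARD('n) + 1 - 0)"
    using 1 level_maximal_chain[OF assms] by (subst chain_weight_maximal_chain) auto
  also have "\<dots> = 1"
    by (simp flip: power_add)
  finally show ?thesis
    by (simp only: monom_class_sum[symmetric] deg_chow_monom_class)
qed

subsection \<open>Uniqueness of the local degree\<close>

lemma keys_plus_single_absorb: "v \<in> Poly_Mapping.keys m \<Longrightarrow> Poly_Mapping.keys (m + Poly_Mapping.single v 1) = Poly_Mapping.keys m"
  for m :: "'a \<Rightarrow>\<^sub>0 nat"
  by (auto simp only: keys_plus_single)

lemma remove_single: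
  fixes m :: "'a \<Rightarrow>\<^sub>0 nat"
  assumes "0 < Poly_Mapping.lookup m v"
  obtains m' where "m = m' + Poly_Mapping.single v 1"
proof
  show "m = (m - Poly_Mapping.single v 1) + Poly_Mapping.single v 1"
    using assms by (intro poly_mapping_eqI) (auto simp: lookup_add lookup_minus lookup_single when_def)
qed

lemma monom_class_incomparable:
  assumes "v \<in> Poly_Mapping.keys m" "w \<in> Poly_Mapping.keys m" "\<not> v \<le> w" "\<not> w \<le> v"
  shows "monom_class m = 0"
proof -
  obtain m' where m': "m = m' + Poly_Mapping.single v 1"
    using assms(1) by (metis remove_single in_keys_iff neq0_conv)
  have "w \<in> Poly_Mapping.keys m'"
    using assms(2-4) unfolding m' keys_plus_single by auto
  then obtain m'' where m'': "m' = m'' + Poly_Mapping.single w 1"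
    by (metis remove_single in_keys_iff neq0_conv)
  show ?thesis
    unfolding m' m'' monom_class_plus_single mult.assoc C_mult_incomparable[OF assms(4,3)] by simp
qed

lemma sum_monom_class_UNIV:
  assumes "v \<in> Poly_Mapping.keys m"
  shows "(\<Sum>w\<in>UNIV. monom_class (m + Poly_Mapping.single w 1)) = 0"
proof -
  obtain m' where m': "m = m' + Poly_Mapping.single v 1"
    using assms by (metis remove_single in_keys_iff neq0_conv)
  have "(\<Sum>w\<in>UNIV. monom_class (m + Poly_Mapping.single w 1)) = monom_class m' * ((\<Sum>w\<in>UNIV. C w) * C v)"
    unfolding monom_class_plus_single m' sum_distrib_left sum_distrib_right by (simp only: mult_ac)
  then show ?thesis
    by (simp only: sum_C_mult_C mult_zero_right)
qed

lemma sum_monom_class_coord: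
  assumes "v \<in> Poly_Mapping.keys m" "v' \<in> Poly_Mapping.keys m" "v $ i \<noteq> v' $ i"
  shows "(\<Sum>w | w $ i = v $ i. monom_class (m + Poly_Mapping.single w 1)) = 0"
proof -
  obtain m' where m': "m = m' + Poly_Mapping.single v 1"
    using assms(1) by (metis remove_single in_keys_iff neq0_conv)
  have "v' \<in> Poly_Mapping.keys m'"
    using assms(2,3) unfolding m' keys_plus_single by auto
  then obtain m'' where m'': "m' = m'' + Poly_Mapping.single v' 1"
    by (metis remove_single in_keys_iff neq0_conv)
  have "(\<Sum>w | w $ i = v $ i. monom_class (m + Poly_Mapping.single w 1)) =
      monom_class m'' * (C v * C v' * (\<Sum>w | w $ i = v $ i. C w))"
    unfolding monom_class_plus_single m' m'' sum_distrib_left by (simp only: mult_ac)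
  then show ?thesis
    by (simp only: C_mult_C_mult_sum[OF assms(3)] mult_zero_right)
qed

section \<open>Rewriting monomials into maximal chains\<close>

definition degree_monom :: "(bit ^ 'n::finite \<Rightarrow>\<^sub>0 nat) \<Rightarrow> nat"
  where "degree_monom m = (\<Sum>v\<in>UNIV. Poly_Mapping.lookup m v)"

text \<open>The second component of the termination measure: it drops when a factor is exchanged for
  a lower one.\<close>

definition level_sum :: "(bit ^ 'n::finite \<Rightarrow>\<^sub>0 nat) \<Rightarrow> nat"
  where "level_sum m = (\<Sum>v\<in>UNIV. Poly_Mapping.lookup m v * level v)"

lemma degree_monom_plus_single: "degree_monom (m + Poly_Mapping.single v 1) = degree_monom m + 1"
  by (simp add: degree_monom_def lookup_add lookup_single sum.distrib when_def)

lemma level_sum_plus_single: "level_sum (m + Poly_Mapping.single v 1) = level_sum m + level v"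
  by (simp add: level_sum_def lookup_add lookup_single distrib_right sum.distrib when_def if_distrib[of "\<lambda>x. x * _"] cong: if_cong)

lemma degree_monom_eq: "degree_monom m = (\<Sum>v\<in>Poly_Mapping.keys m. Poly_Mapping.lookup m v)"
  unfolding degree_monom_def by (rule sum.mono_neutral_right) (auto simp: in_keys_iff)

lemma card_keys_le: "card (Poly_Mapping.keys m) \<le> degree_monom m"
proof -
  have "(\<Sum>v\<in>Poly_Mapping.keys m. 1) \<le> (\<Sum>v\<in>Poly_Mapping.keys m. Poly_Mapping.lookup m v)"
    by (rule sum_mono) (simp add: in_keys_iff)
  then show ?thesis
    by (simp add: degree_monom_eq)
qed

lemma monom_class_squarefree:
  assumes "\<And>v. Poly_Mapping.lookup m v \<le> 1"
  shows "monom_class m = (\<Prod>v\<in>Poly_Mapping.keys m. C v)"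
proof -
  have "m = (\<Sum>v\<in>Poly_Mapping.keys m. Poly_Mapping.single v 1)"
  proof (rule poly_mapping_eqI)
    fix k
    have "(\<Sum>v\<in>Poly_Mapping.keys m. (1::nat) when v = k) = Poly_Mapping.lookup m k"
      using assms[of k] by (auto simp: when_def sum.delta in_keys_iff)
    then show "Poly_Mapping.lookup m k = Poly_Mapping.lookup (\<Sum>v\<in>Poly_Mapping.keys m. Poly_Mapping.single v 1) k"
      by (simp add: lookup_sum lookup_single)
  qed
  then show ?thesis
    using monom_class_sum[of id "Poly_Mapping.keys m"] by simp
qed

text \<open>The set \<open>S\<close> is a subgroup, and the relation is solved for its
  \<open>v\<close>-term.\<close>

lemma monom_class_in_span_step:
  fixes S :: "'n::finite chow set"
  assumes add: "\<And>x y. x \<in> S \<Longrightarrow> y \<in> S \<Longrightarrow> x + y \<in> S" and uminus: "\<And>x. x \<in> S \<Longrightarrow> - x \<in> S"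
    and zero: "0 \<in> S"
    and sum: "(\<Sum>w\<in>A. monom_class (m + Poly_Mapping.single w 1)) = 0"
    and v: "v \<in> A" and others: "\<And>w. w \<in> A \<Longrightarrow> w \<noteq> v \<Longrightarrow> monom_class (m + Poly_Mapping.single w 1) \<in> S"
  shows "monom_class (m + Poly_Mapping.single v 1) \<in> S"
proof -
  have sum_S: "sum f B \<in> S" if "\<And>w. w \<in> B \<Longrightarrow> f w \<in> S" for B and f :: "bit ^ 'n \<Rightarrow> 'n chow"
    using that by (induction B rule: infinite_finite_induct) (auto intro: zero add)
  have "monom_class (m + Poly_Mapping.single v 1) = - (\<Sum>w\<in>A - {v}. monom_class (m + Poly_Mapping.single w 1))"
    using sum v by (subst (asm) sum.remove[of _ v]) (auto simp: eq_neg_iff_add_eq_0)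
  then show ?thesis
    using others by (simp only:) (intro uminus sum_S; blast)
qed

text \<open>
  A repeated factor is replaced, using a relation, by factors that either enlarge the support or lie
  further down in it; hence the lexicographic measure.
\<close>

lemma monom_class_in_span_of_chains:
  fixes S :: "'n::finite chow set"
  assumes add: "\<And>x y. x \<in> S \<Longrightarrow> y \<in> S \<Longrightarrow> x + y \<in> S" and uminus: "\<And>x. x \<in> S \<Longrightarrow> - x \<in> S"
    and zero: "0 \<in> S"
    and chain: "\<And>c. strict_mono_on {0..CARD('n)} c \<Longrightarrow> (\<Prod>i=0..CARD('n). C (c i)) \<in> S"
  shows "degree_monom m = CARD('n) + 1 \<Longrightarrow> monom_class m \<in> S"
proof (induction m rule: wf_induct_rule[OF wf_measures[of "[\<lambda>m. CARD('n) + 1 - card (Poly_Mapping.keys m), level_sum]"]])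
  case (1 m)
  let ?keys = "Poly_Mapping.keys m"
  have IH: "monom_class m' \<in> S" if "degree_monom m' = CARD('n) + 1"
    "card ?keys < card (Poly_Mapping.keys m') \<or> Poly_Mapping.keys m' = ?keys \<and> level_sum m' < level_sum m" for m'
    using 1 that card_keys_le[of m'] by (auto simp: diff_less_mono2)
  \<comment> \<open>The monomial is 0 by relation (1), or squarefree on a chain and hence a maximal
    chain by its degree, or it has a repeated factor to be exchanged.\<close>
  consider "\<not> ?keys \<subseteq> comparable ?keys" | "?keys \<subseteq> comparable ?keys" "\<And>v. Poly_Mapping.lookup m v \<le> 1"
    | v where "?keys \<subseteq> comparable ?keys" "2 \<le> Poly_Mapping.lookup m v"
    by (metis Suc_1 not_less_eq_eq)
  then show ?case
  proof cases
    case 1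
    then obtain v w where "v \<in> ?keys" "w \<in> ?keys" "\<not> v \<le> w" "\<not> w \<le> v"
      by (auto simp: comparable_def)
    then show ?thesis
      using monom_class_incomparable zero by metis
  next
    case 2
    obtain vs where vs: "sorted_wrt (<) vs" "set vs = ?keys"
      using sorted_list_of_chain[OF finite_keys 2(1)] by metis
    have "distinct vs"
      using vs(1) by (induction vs) auto
    have one: "Poly_Mapping.lookup m v = 1" if "v \<in> ?keys" for v
      using 2(2)[of v] that unfolding in_keys_iff by linarith
    have "degree_monom m = card ?keys"
      unfolding degree_monom_eq by (subst sum.cong[OF refl one]) simp_all
    then have "length vs = CARD('n) + 1"
      using distinct_card[OF \<open>distinct vs\<close>] vs(2) \<open>degree_monom m = CARD('n) + 1\<close> by metis
    then have "strict_mono_on {0..CARD('n)} ((!) vs)"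
      using sorted_wrt_nth_less[OF vs(1)] by (intro strict_mono_onI) auto
    from chain[OF this] have "(\<Prod>i=0..CARD('n). C (vs ! i)) \<in> S" .
    also have "(\<Prod>i=0..CARD('n). C (vs ! i)) = (\<Prod>i<length vs. C (vs ! i))"
      using \<open>length vs = CARD('n) + 1\<close> by (intro prod.cong) auto
    also have "\<dots> = (\<Prod>v\<in>set vs. C v)"
      by (rule prod.reindex_bij_betw[OF bij_betw_nth[OF \<open>distinct vs\<close> refl refl]])
    also have "\<dots> = monom_class m"
      unfolding vs(2) by (rule monom_class_squarefree[OF 2(2), symmetric])
    finally show ?thesis .
  next
    case 3
    obtain m' where m': "m = m' + Poly_Mapping.single v 1"
      using remove_single[of m v] 3(2) by auto
    have "Poly_Mapping.lookup m v = Poly_Mapping.lookup m' v + 1"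
      unfolding m' by (simp add: lookup_add)
    then have v: "v \<in> Poly_Mapping.keys m'"
      using 3(2) by (simp add: in_keys_iff)
    then have keys: "?keys = Poly_Mapping.keys m'"
      unfolding m' by (rule keys_plus_single_absorb)
    have degree: "degree_monom (m' + Poly_Mapping.single w 1) = CARD('n) + 1" for w
      using \<open>degree_monom m = CARD('n) + 1\<close> unfolding m' degree_monom_plus_single .
    \<comment> \<open>One copy of \<open>v\<close> may be exchanged for any \<open>w\<close> that is
      new to the support or lies below \<open>v\<close>. In the first case the support grows; in the
      second it stays the same and the level sum drops.\<close>
    have move: "monom_class (m' + Poly_Mapping.single w 1) \<in> S" if "w \<in> ?keys \<Longrightarrow> w < v" for w
    proof (rule IH[OF degree], cases "w \<in> ?keys")
      case True
      then show "card ?keys < card (Poly_Mapping.keys (m' + Poly_Mapping.single w 1)) \<or>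
          Poly_Mapping.keys (m' + Poly_Mapping.single w 1) = ?keys \<and>
          level_sum (m' + Poly_Mapping.single w 1) < level_sum m"
        using level_strict_mono[OF that[OF True]] keys_plus_single_absorb[of w m'] keys
        unfolding m' level_sum_plus_single by simp
    next
      case False
      then show "card ?keys < card (Poly_Mapping.keys (m' + Poly_Mapping.single w 1)) \<or>
          Poly_Mapping.keys (m' + Poly_Mapping.single w 1) = ?keys \<and>
          level_sum (m' + Poly_Mapping.single w 1) < level_sum m"
        unfolding keys_plus_single keys by simp
    qed
    have comparable: "u \<le> w \<or> w \<le> u" if "u \<in> ?keys" "w \<in> ?keys" for u w
      using 3(1) that by (auto simp: comparable_def)
    have coord: "\<exists>i. u $ i = 0 \<and> w $ i = 1" if less: "u < w" for u w :: "bit ^ 'n"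
    proof -
      obtain i where "i \<in> ones w - ones u"
        using psubset_imp_ex_mem less[unfolded ones_less_iff] by blast
      then show ?thesis
        using bit_eq_0_or_1[of "u $ i"] by (auto simp: ones_def)
    qed
    have coord_mono: "w $ i = 1" if "u \<le> w" "u $ i = 1" for u w :: "bit ^ 'n" and i
      using that by (simp add: less_eq_vec_def less_eq_bit_def)
    note step = monom_class_in_span_step[where m = m' and v = v, OF add uminus zero, folded m']
    have "u < v \<or> v < u" if "u \<in> ?keys" "u \<noteq> v" for u
      using comparable[of u v] that v keys by (auto simp: order_le_less)
    then consider "\<exists>u\<in>?keys. v < u" | "\<not> (\<exists>u\<in>?keys. v < u)" "\<exists>u\<in>?keys. u < v" | "?keys = {v}"
      using v keys by blast
    then show ?thesis
    proof cases
      case 1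
      \<comment> \<open>The element \<open>u\<close> is the successor of \<open>v\<close> in the
        chain, and coordinate \<open>i\<close> separates the two. A chain element that shares the
        coordinate 0 with \<open>v\<close> cannot lie at or above \<open>u\<close>, so it is at most
        \<open>v\<close>.\<close>
      then obtain u where u: "u \<in> ?keys" "v < u" and min: "\<And>w. w \<in> ?keys \<Longrightarrow> v < w \<Longrightarrow> level u \<le> level w"
        using ex_has_least_nat[of "\<lambda>u. u \<in> ?keys \<and> v < u" _ level] by blast
      obtain i where i: "v $ i = 0" "u $ i = 1"
        using coord[OF u(2)] by blast
      show ?thesis
      proof (rule step[of "{w. w $ i = v $ i}"])
        show "v \<in> {w. w $ i = v $ i}"
          by simp
        show "(\<Sum>w | w $ i = v $ i. monom_class (m' + Poly_Mapping.single w 1)) = 0"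
          using u(1) v i unfolding keys by (intro sum_monom_class_coord) auto
        fix w assume w: "w \<in> {w. w $ i = v $ i}" "w \<noteq> v"
        show "monom_class (m' + Poly_Mapping.single w 1) \<in> S"
        proof (rule move)
          assume "w \<in> ?keys"
          have "\<not> u \<le> w"
            using coord_mono[of u w i] w(1) i by auto
          then have "w < u"
            using comparable[OF u(1) \<open>w \<in> ?keys\<close>] by (auto simp: order_le_less)
          then have "\<not> v < w"
            using min[OF \<open>w \<in> ?keys\<close>] level_strict_mono[of w u] by auto
          then show "w < v"
            using comparable[of v w] v w(2) \<open>w \<in> ?keys\<close> keys by (auto simp: order_le_less)
        qed
      qed
    next
      case 2
      \<comment> \<open>Now \<open>v\<close> is the top of the support, so every other chain element
        is below it. The smaller element \<open>u\<close> supplies the second vector for relation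
        (3).\<close>
      then obtain u where u: "u \<in> ?keys" "u < v"
        by blast
      obtain i where i: "u $ i = 0" "v $ i = 1"
        using coord[OF u(2)] by blast
      show ?thesis
      proof (rule step[of "{w. w $ i = v $ i}"])
        show "v \<in> {w. w $ i = v $ i}"
          by simp
        show "(\<Sum>w | w $ i = v $ i. monom_class (m' + Poly_Mapping.single w 1)) = 0"
          using u(1) v i unfolding keys by (intro sum_monom_class_coord) auto
        fix w assume w: "w \<in> {w. w $ i = v $ i}" "w \<noteq> v"
        show "monom_class (m' + Poly_Mapping.single w 1) \<in> S"
        proof (rule move)
          assume "w \<in> ?keys"
          then show "w < v"
            using comparable[of v w] v w(2) 2(1) keys by (auto simp: order_le_less)
        qed
      qed
    next
      case 3
      \<comment> \<open>With support \<open>{v}\<close>, relation (2) exchanges one copy of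
        \<open>v\<close> for vectors outside the support.\<close>
      show ?thesis
      proof (rule step[of UNIV])
        show "(\<Sum>w\<in>UNIV. monom_class (m' + Poly_Mapping.single w 1)) = 0"
          by (rule sum_monom_class_UNIV[OF v])
        fix w assume "w \<noteq> v"
        then show "monom_class (m' + Poly_Mapping.single w 1) \<in> S"
          using 3 by (intro move) simp
      qed simp_all
    qed
  qed
qed

text \<open>Stated for an arbitrary subgroup \<open>S\<close>, so that it applies to the set on
  which two additive functions agree.\<close>

lemma chow_part_in_span_of_chains:
  fixes S :: "'n::finite chow set"
  assumes add: "\<And>x y. x \<in> S \<Longrightarrow> y \<in> S \<Longrightarrow> x + y \<in> S" and uminus: "\<And>x. x \<in> S \<Longrightarrow> - x \<in> S"
    and zero: "0 \<in> S"
    and chain: "\<And>c. strict_mono_on {0..CARD('n)} c \<Longrightarrow> (\<Prod>i=0..CARD('n). C (c i)) \<in> S"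
  shows "chow_part (CARD('n) + 1) \<subseteq> S"
proof
  fix x :: "'n chow"
  assume "x \<in> chow_part (CARD('n) + 1)"
  then obtain p where p: "homogeneous (CARD('n) + 1) p" "x = abs_chow p"
    by (auto simp: chow_part_def)
  \<comment> \<open>Integer coefficients are reached from 0 by steps of 1 in both
    directions.\<close>
  have single: "abs_chow (Poly_Mapping.single m k) \<in> S" if "degree_monom m = CARD('n) + 1" for m k
  proof (induction k rule: int_induct[of _ 0])
    case base
    then show ?case
      by (simp add: zero flip: zero_chow.abs_eq)
  next
    case (step1 k)
    then show ?case
      unfolding single_add abs_chow_plus
      by (intro add) (use monom_class_in_span_of_chains[OF assms that] in \<open>simp_all add: monom_class_def\<close>)
  next
    case (step2 k)
    then show ?case
      unfolding diff_conv_add_uminus single_add single_uminus abs_chow_plus abs_chow_uminus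
      by (intro add uminus) (use monom_class_in_span_of_chains[OF assms that] in \<open>simp_all add: monom_class_def\<close>)
  qed
  have sum_S: "(\<Sum>m\<in>A. abs_chow (Poly_Mapping.single m (k m))) \<in> S" if "\<And>m. m \<in> A \<Longrightarrow> degree_monom m = CARD('n) + 1" for A k
    using that
  proof (induction A rule: infinite_finite_induct)
    case (insert m A)
    then show ?case
      unfolding sum.insert[OF insert.hyps] by (intro add single) blast+
  qed (simp_all add: zero)
  have "x = (\<Sum>m\<in>Poly_Mapping.keys p. abs_chow (Poly_Mapping.single m (Poly_Mapping.lookup p m)))"
    unfolding p(2) abs_chow_sum[symmetric] by (rule arg_cong[OF poly_eq_sum_single])
  also have "\<dots> \<in> S"
    using p(1) by (intro sum_S) (simp add: homogeneous_def degree_monom_def)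
  finally show "x \<in> S" .
qed

section \<open>The graded pieces and the identification of \<open>ldeg\<close>\<close>

lemma homogeneous_add: "homogeneous k p \<Longrightarrow> homogeneous k q \<Longrightarrow> homogeneous k (p + q)"
  unfolding homogeneous_def using keys_add[of p q] by blast

lemma chow_part_add: "x \<in> chow_part k \<Longrightarrow> y \<in> chow_part k \<Longrightarrow> x + y \<in> chow_part k"
  unfolding chow_part_def by (auto simp flip: abs_chow_plus intro: homogeneous_add)

lemma chow_part_uminus: "x \<in> chow_part k \<Longrightarrow> - x \<in> chow_part k"
  unfolding chow_part_def by (auto simp: homogeneous_def in_keys_iff simp flip: abs_chow_uminus)

lemma chow_part_zero: "0 \<in> chow_part k"
proof -
  have "homogeneous k 0"
    by (simp add: homogeneous_def)
  then show ?thesis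
    unfolding chow_part_def zero_chow.abs_eq by (rule imageI[OF CollectI])
qed

lemma chow_part_chain:
  fixes c :: "nat \<Rightarrow> bit ^ 'n::finite"
  shows "(\<Prod>i=0..k. C (c i)) \<in> chow_part (k + 1)"
proof -
  have "degree_monom (\<Sum>i\<in>A. Poly_Mapping.single (c i) 1) = card A" for A
    by (induction A rule: infinite_finite_induct)
      (simp_all add: degree_monom_def lookup_add lookup_single sum.distrib when_def)
  then have "homogeneous (k + 1) (Poly_Mapping.single (\<Sum>i\<in>{0..k}. Poly_Mapping.single (c i) 1) 1)"
    by (simp add: homogeneous_def degree_monom_def)
  then show ?thesis
    unfolding monom_class_sum[symmetric] monom_class_def chow_part_def by blast
qed

text \<open>The restriction of \<open>deg_chow\<close> satisfies the description of
  \<open>ldeg\<close>. Any other candidate agrees with it on maximal chains, hence on the subgroup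
  they generate, which contains the whole graded piece.\<close>

lemma ldeg_eq_deg_chow:
  fixes x :: "'n::finite chow"
  assumes "x \<in> chow_part (CARD('n) + 1)"
  shows "ldeg x = deg_chow x"
proof -
  let ?part = "chow_part (CARD('n) + 1) :: 'n chow set"
  let ?P = "\<lambda>f :: 'n chow \<Rightarrow> int. f \<in> extensional ?part \<and>
    (\<forall>x\<in>?part. \<forall>y\<in>?part. f (x + y) = f x + f y) \<and>
    (\<forall>c :: nat \<Rightarrow> bit ^ 'n. strict_mono_on {0..CARD('n)} c \<longrightarrow> f (\<Prod>i=0..CARD('n). C (c i)) = 1)"
  let ?f = "restrict deg_chow ?part"
  have "?P ?f"
    by (auto simp: deg_chow_add chow_part_add deg_chow_maximal_chain chow_part_chain[simplified])
  moreover have "g = ?f" if g: "?P g" for g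
  proof (rule extensionalityI)
    show "g \<in> extensional ?part" "?f \<in> extensional ?part"
      using g by auto
    let ?S = "{x \<in> ?part. g x = deg_chow x}"
    have g_add: "g (x + y) = g x + g y" if "x \<in> ?part" "y \<in> ?part" for x y
      using g that by blast
    have d0: "deg_chow (0 :: 'n chow) = 0"
      using deg_chow_add[of 0 "0 :: 'n chow"] by simp
    have g0: "g 0 = 0"
      using g_add[OF chow_part_zero chow_part_zero] by simp
    have "?part \<subseteq> ?S"
    proof (rule chow_part_in_span_of_chains)
      show "0 \<in> ?S"
        using d0 g0 chow_part_zero by (simp only: mem_Collect_eq simp_thms)
      show "x + y \<in> ?S" if "x \<in> ?S" "y \<in> ?S" for x y
        using that by (auto simp: chow_part_add g_add deg_chow_add)
      show "- x \<in> ?S" if "x \<in> ?S" for x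
      proof -
        have "g x + g (- x) = 0" "deg_chow x + deg_chow (- x) = 0"
          using that g_add[of x "- x"] deg_chow_add[of x "- x"] by (auto simp: chow_part_uminus g0 d0)
        then show ?thesis
          using that by (auto simp: chow_part_uminus)
      qed
      show "(\<Prod>i=0..CARD('n). C (c i)) \<in> ?S" if "strict_mono_on {0..CARD('n)} c" for c
        using that g chow_part_chain[where c = c and k = "CARD('n)"] by (auto simp: deg_chow_maximal_chain)
    qed
    then show "g x = ?f x" if "x \<in> ?part" for x
      using that by auto
  qed
  ultimately have "ldeg = ?f"
    unfolding ldeg_def by (rule the_equality)
  from fun_cong[OF this, of x] show ?thesis
    using assms by (simp only: restrict_apply if_True)
qed

lemma ldeg_0: "ldeg (0 :: 'n::finite chow) = 0"
proof -
  have "ldeg (0 :: 'n chow) = deg_chow (0 :: 'n chow)"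
    by (rule ldeg_eq_deg_chow[OF chow_part_zero])
  then show ?thesis
    using deg_chow_add[of 0 "0 :: 'n chow"] by simp
qed

subsection \<open>The vanishing condition in dimensions two and three\<close>

lemma ones_axis: "ones (axis i 1) = {i}"
  by (auto simp: ones_def axis_def)

lemma ones_axis_add: "i \<noteq> j \<Longrightarrow> ones (axis i 1 + axis j 1) = {i, j}"
  by (auto simp: ones_def axis_def)

lemma ones_eq_empty_iff: "ones v = {} \<longleftrightarrow> v = 0"
proof -
  have "ones (0 :: bit ^ 'a) = {}"
    by (simp add: ones_def)
  then show ?thesis
    using ones_inject[of v 0] by simp
qed

lemma prod_eq_0_of_pair:
  fixes f :: "nat \<Rightarrow> 'a::comm_ring_1"
  assumes "finite I" "k \<in> I" "l \<in> I" "k \<noteq> l" "f k * f l = 0"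
  shows "prod f I = 0"
proof -
  have "prod f I = f k * prod f (I - {k})"
    by (rule prod.remove[OF assms(1,2)])
  also have "prod f (I - {k}) = f l * prod f (I - {k} - {l})"
    by (rule prod.remove) (use assms in auto)
  finally have "prod f I = f k * f l * prod f (I - {k} - {l})"
    by (simp only: mult.assoc)
  then show ?thesis
    using assms(5) by simp
qed

section \<open>Counting the blocks met by a vector\<close>

lemma alpha_pos:
  fixes P :: "'n::finite set set"
  assumes "partition_on UNIV P" "v \<noteq> 0"
  shows "1 \<le> alpha P v"
proof -
  obtain j where j: "v $ j = 1"
    using assms(2) ones_eq_empty_iff[of v] by (auto simp: ones_def)
  then obtain B where "B \<in> P" "j \<in> B"
    using assms(1) by (auto simp: partition_on_def)
  then have "{B \<in> P. \<exists>j\<in>B. v $ j = 1} \<noteq> {}"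
    using j by blast
  then show ?thesis
    by (simp add: alpha_def Suc_le_eq card_gt_0_iff)
qed

lemma sum_card_partition:
  fixes P :: "'n::finite set set"
  assumes "partition_on UNIV P"
  shows "(\<Sum>B\<in>P. card B) = CARD('n)"
proof -
  have "card (\<Union>P) = (\<Sum>B\<in>P. card B)"
    using assms by (intro card_Union_disjoint) (auto simp: partition_on_def disjoint_def pairwise_def disjnt_def)
  then show ?thesis
    using assms by (simp add: partition_on_def)
qed

lemma partition_block_card_pos:
  fixes P :: "'n::finite set set"
  assumes "partition_on UNIV P" "B \<in> P"
  shows "1 \<le> card B"
  using assms by (metis One_nat_def Suc_leI card_gt_0_iff finite partition_on_def)

lemma card_partition_le:
  fixes P :: "'n::finite set set"
  assumes "partition_on UNIV P"
  shows "card P \<le> CARD('n)"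
proof -
  have "(\<Sum>B\<in>P. 1) \<le> (\<Sum>B\<in>P. card B)"
    by (rule sum_mono) (rule partition_block_card_pos[OF assms])
  then show ?thesis
    by (simp add: sum_card_partition[OF assms])
qed

text \<open>Blocks are nonempty and their sizes add up to \<open>CARD('n)\<close>. With
  \<open>CARD('n)\<close> blocks each is a singleton, so blocks met and coordinates equal to 1 are
  the same in number.\<close>

lemma alpha_discrete:
  fixes P :: "'n::finite set set"
  assumes "partition_on UNIV P" "card P = CARD('n)"
  shows "alpha P v = level v"
proof -
  have "card B = 1" if "B \<in> P" for B
  proof (rule ccontr)
    assume "card B \<noteq> 1"
    then have "1 < card B"
      using partition_block_card_pos[OF assms(1) that] by simp
    then have "(\<Sum>B\<in>P. 1) < (\<Sum>B\<in>P. card B)"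
      using that partition_block_card_pos[OF assms(1)] by (intro sum_strict_mono_ex1) auto
    then show False
      using assms(2) by (simp add: sum_card_partition[OF assms(1)])
  qed
  then have single: "\<exists>x. B = {x}" if "B \<in> P" for B
    using that card_1_singletonE by metis
  have all: "{x} \<in> P" for x
  proof -
    obtain B where "B \<in> P" "x \<in> B"
      using assms(1) by (auto simp: partition_on_def)
    then show ?thesis
      using single[of B] by auto
  qed
  have "{B \<in> P. \<exists>j\<in>B. v $ j = 1} = (\<lambda>x. {x}) ` ones v"
  proof (intro set_eqI iffI)
    fix B assume B: "B \<in> {B \<in> P. \<exists>j\<in>B. v $ j = 1}"
    then obtain x where "B = {x}"
      using single by blast
    with B show "B \<in> (\<lambda>x. {x}) ` ones v"
      by (simp add: ones_def)
  qed (use all in \<open>auto simp: ones_def\<close>)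
  then show ?thesis
    by (simp add: alpha_def level_def card_image)
qed

section \<open>Vanishing products for each type of partition\<close>

lemma prod_F_eq_0_of_ones:
  fixes v :: "nat \<Rightarrow> bit ^ 'n::finite"
  assumes "i \<noteq> j" "\<And>l. l \<le> 3 \<Longrightarrow> ones (v l) \<in> {{i}, {j}, {k}, {i, j}}"
  shows "(\<Prod>l=0..3. F (v l)) = 0"
proof (rule F_product_eq_0)
  have single: "w = axis x 1" if "ones w = {x}" for w x
    using that ones_axis[of x] ones_inject by metis
  have pair: "w = axis i 1 + axis j 1" if "ones w = {i, j}" for w
    using that ones_axis_add[OF assms(1)] ones_inject by metis
  fix l :: nat
  assume "l \<le> 3"
  then have "ones (v l) = {i} \<or> ones (v l) = {j} \<or> ones (v l) = {k} \<or> ones (v l) = {i, j}"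
    using assms(2) by blast
  then show "v l \<in> {axis i 1, axis j 1, axis k 1, axis i 1 + axis j 1}"
    using single[of "v l"] pair[of "v l"] by (elim disjE) simp_all
qed

text \<open>Of three unit vectors in two coordinates two coincide, and the square of their
  \<open>F\<close> kills the third factor.\<close>

lemma prod_F_eq_0_dim_2:
  fixes v :: "nat \<Rightarrow> bit ^ 'n::finite"
  assumes "CARD('n) = 2" "\<And>l. l \<le> 2 \<Longrightarrow> level (v l) = 1"
  shows "(\<Prod>l=0..2. F (v l)) = 0"
proof -
  have axis: "\<exists>i. v l = axis i 1" if "l \<le> 2" for l
    using assms(2)[OF that] unfolding level_def
    by (metis card_1_singletonE ones_axis ones_inject)
  obtain a b c where abc: "v 0 = axis a 1" "v 1 = axis b 1" "v 2 = axis c 1"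
    using axis[of 0] axis[of 1] axis[of 2] by auto
  have "card {a, b, c} \<le> 2"
    using card_mono[of UNIV "{a, b, c}"] assms(1) by simp
  then consider "a = b" | "a = c" | "b = c"
    by (auto simp: card_insert_if split: if_splits)
  then have "F (v 0) * F (v 1) * F (v 2) = 0"
  proof cases
    case 1
    then show ?thesis
      unfolding abc using F_axis_square_mult_F[of b "axis c 1"] by (simp add: power2_eq_square)
  next
    case 2
    then show ?thesis
      unfolding abc using F_axis_square_mult_F[of c "axis b 1"] by (simp add: power2_eq_square mult_ac)
  next
    case 3
    then show ?thesis
      unfolding abc using F_axis_square_mult_F[of c "axis a 1"] by (simp add: power2_eq_square mult_ac)
  qed
  then show ?thesis
    by (simp add: numeral_eq_Suc mult_ac)
qed

text \<open>Four levels that are at least 1 and add up to at most 5 include at most one 2. If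
  \<open>{i, j}\<close> is the support of that vector and \<open>k\<close> the third coordinate,
  only the supports \<open>{i}\<close>, \<open>{j}\<close>, \<open>{k}\<close>,
  \<open>{i, j}\<close> occur.\<close>

lemma prod_F_eq_0_dim_3_discrete:
  fixes v :: "nat \<Rightarrow> bit ^ 'n::finite"
  assumes "CARD('n) = 3" "\<And>l. l \<le> 3 \<Longrightarrow> 1 \<le> level (v l)" "(\<Sum>l=0..3. level (v l)) < 6"
  shows "(\<Prod>l=0..3. F (v l)) = 0"
proof -
  define e where "e l = level (v l) - 1" for l
  have level: "level (v l) = e l + 1" if "l \<in> {0..3}" for l
    using assms(2)[of l] that by (simp add: e_def)
  have "(\<Sum>l=0..3. level (v l)) = (\<Sum>l=0..3. e l + 1)"
    by (rule sum.cong[OF refl level])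
  also have "\<dots> = (\<Sum>l=0..3. e l) + 4"
    unfolding sum.distrib by simp
  finally have total: "(\<Sum>l=0..3. e l) \<le> 1"
    using assms(3) by linarith
  have le: "level (v l) = 1 \<or> level (v l) = 2" if "l \<le> 3" for l
  proof -
    have "e l \<le> (\<Sum>l=0..3. e l)"
      using that by (intro member_le_sum) simp_all
    moreover have "level (v l) = e l + 1"
      using level that by simp
    ultimately show ?thesis
      using total by linarith
  qed
  have unique: "k = l" if "k \<le> 3" "l \<le> 3" "level (v k) = 2" "level (v l) = 2" for k l
  proof (rule ccontr)
    assume "k \<noteq> l"
    have "sum e {k, l} \<le> (\<Sum>l=0..3. e l)"
      using that by (intro sum_mono2) auto
    then show False
      using total \<open>k \<noteq> l\<close> level[of k] level[of l] that by simp
  qed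
  obtain i j where ij: "i \<noteq> j" "\<And>l. l \<le> 3 \<Longrightarrow> level (v l) = 2 \<Longrightarrow> ones (v l) = {i, j}"
  proof (cases "\<exists>l\<le>3. level (v l) = 2")
    case True
    then obtain l where l: "l \<le> 3" "level (v l) = 2" by blast
    then obtain i j where "ones (v l) = {i, j}" "i \<noteq> j"
      unfolding level_def card_2_iff by blast
    moreover have "k = l" if "k \<le> 3" "level (v k) = 2" for k
      using unique[OF that(1) l(1) that(2) l(2)] .
    ultimately show ?thesis
      by (intro that[of i j]) simp_all
  next
    case False
    \<comment> \<open>Without a vector of level 2, any two distinct coordinates will do.\<close>
    obtain i j k :: 'n where "UNIV = {i, j, k}" "i \<noteq> j"
      using assms(1) unfolding card_3_iff by blast
    then show ?thesis
      using False by (intro that[of i j]) simp_all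
  qed
  have "card (UNIV - {i, j}) = 1"
    using assms(1) ij(1) by (simp add: card_Diff_subset)
  then obtain k where Diff: "UNIV - {i, j} = {k}"
    by (rule card_1_singletonE)
  have k: "x \<in> {i, j, k}" for x
  proof (cases "x \<in> {i, j}")
    case False
    then have "x \<in> {k}"
      unfolding Diff[symmetric] by simp
    then show ?thesis
      by simp
  qed auto
  show ?thesis
  proof (rule prod_F_eq_0_of_ones[OF ij(1)])
    fix l :: nat
    assume l: "l \<le> 3"
    show "ones (v l) \<in> {{i}, {j}, {k}, {i, j}}"
    proof (cases "level (v l) = 2")
      case True
      then show ?thesis
        using ij(2)[OF l] by simp
    next
      case False
      then obtain x where "ones (v l) = {x}"
        using le[OF l] card_1_singletonE[of "ones (v l)"] unfolding level_def by auto
      then show ?thesis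
        using k[of x] by auto
    qed
  qed
qed

text \<open>The blocks have sizes 2 and 1. The value 1 of \<open>alpha\<close> confines each support
  to one block, which leaves the same four supports as in the discrete case.\<close>

lemma prod_F_eq_0_dim_3_two_blocks:
  fixes v :: "nat \<Rightarrow> bit ^ 'n::finite"
  assumes "CARD('n) = 3" "partition_on UNIV P" "card P = 2" "\<And>l. l \<le> 3 \<Longrightarrow> alpha P (v l) = 1"
  shows "(\<Prod>l=0..3. F (v l)) = 0"
proof -
  obtain A B where P: "P = {A, B}" "A \<noteq> B" "card B \<le> card A"
  proof -
    obtain X Y where XY: "P = {X, Y}" "X \<noteq> Y"
      using assms(3) unfolding card_2_iff by blast
    show thesis
    proof (cases "card Y \<le> card X")
      case True
      with XY show thesis
        by (rule that)
    next
      case False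
      then have "card X \<le> card Y"
        by linarith
      with XY(1)[unfolded insert_commute[of X]] XY(2)[symmetric] show thesis
        by (rule that)
    qed
  qed
  have "card A + card B = 3"
    using sum_card_partition[OF assms(2)] assms(1) P by simp
  moreover have "1 \<le> card B"
    using partition_block_card_pos[OF assms(2)] P(1) by blast
  ultimately have "card A = 2" "card B = 1"
    using P(3) by linarith+
  obtain i j where ij: "A = {i, j}" "i \<noteq> j"
    using \<open>card A = 2\<close> unfolding card_2_iff by blast
  obtain k where "B = {k}"
    using \<open>card B = 1\<close> by (rule card_1_singletonE)
  note ijk = ij this
  show ?thesis
  proof (rule prod_F_eq_0_of_ones[OF ijk(2)])
    fix l :: nat
    assume "l \<le> 3"
    then have "card {B \<in> P. \<exists>j\<in>B. v l $ j = 1} = 1"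
      using assms(4) by (simp only: alpha_def)
    then obtain D where D: "{B \<in> P. \<exists>j\<in>B. v l $ j = 1} = {D}"
      by (rule card_1_singletonE)
    then have "D \<in> {B \<in> P. \<exists>j\<in>B. v l $ j = 1}"
      by simp
    then obtain x where x: "D \<in> P" "x \<in> D" "x \<in> ones (v l)"
      by (auto simp: ones_def)
    have "y \<in> D" if "y \<in> ones (v l)" for y
    proof -
      have "y \<in> \<Union>P"
        using assms(2) by (simp add: partition_on_def)
      then obtain E where "E \<in> P" "y \<in> E"
        by blast
      then have "E \<in> {B \<in> P. \<exists>j\<in>B. v l $ j = 1}"
        using that by (auto simp: ones_def)
      then show ?thesis
        using \<open>y \<in> E\<close> unfolding D by simp
    qed
    then have "ones (v l) \<subseteq> D"
      by blast
    moreover have "D = {i, j} \<or> D = {k}"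
      using x(1) unfolding P(1) ijk by simp
    ultimately show "ones (v l) \<in> {{i}, {j}, {k}, {i, j}}"
      using x(3) by (elim disjE; simp only:; blast)
  qed
qed

theorem corollary4p36:
  fixes P :: "'n::finite set set"
    and v :: "nat \<Rightarrow> bit ^ 'n"
  assumes "CARD('n) = 2 \<or> CARD('n) = 3"
    and "partition_on UNIV P"
    and "(\<Sum>i=0..CARD('n). alpha P (v i)) < CARD('n) + card P"
  shows "ldeg (\<Prod>i=0..CARD('n). F (v i)) = 0"
proof -
  have "(\<Prod>i=0..CARD('n). F (v i)) = 0"
  proof (cases "\<exists>l\<in>{0..CARD('n)}. v l = 0")
    case True
    \<comment> \<open>By relation (2), \<open>F 0\<close> multiplied by any other factor
      vanishes.\<close>
    then obtain l where l: "l \<in> {0..CARD('n)}" "v l = 0" by blast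
    obtain k where "k \<in> {0..CARD('n)}" "k \<noteq> l"
      using assms(1) by (cases "l = 0") (auto intro: that[of 1] that[of 0])
    with l show ?thesis
      by (intro prod_eq_0_of_pair[of _ l k]) (simp_all only: finite_atLeastAtMost F_zero_mult_F not_sym)
  next
    case False
    then have pos: "1 \<le> alpha P (v l)" if "l \<le> CARD('n)" for l
      using that by (intro alpha_pos[OF assms(2)]) auto
    \<comment> \<open>The lower bound \<open>CARD('n) + 1\<close> for the sum excludes the partition
      into one block.\<close>
    have "(\<Sum>l=0..CARD('n). 1) \<le> (\<Sum>l=0..CARD('n). alpha P (v l))"
      by (intro sum_mono pos) simp
    then have "2 \<le> card P"
      using assms(3) by simp
    then consider "CARD('n) = 2" "card P = 2" | "CARD('n) = 3" "card P = 3" | "CARD('n) = 3" "card P = 2"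
      using assms(1) card_partition_le[OF assms(2)] by linarith
    then show ?thesis
    proof cases
      case 1
      then have "level (v 0) + level (v 1) + level (v 2) < 4"
        using assms(3) alpha_discrete[OF assms(2)] by (simp add: numeral_eq_Suc)
      moreover have "1 \<le> level (v l)" if "l \<le> 2" for l
        using pos[of l] that 1 alpha_discrete[OF assms(2)] by simp
      then have "1 \<le> level (v 0)" "1 \<le> level (v 1)" "1 \<le> level (v 2)"
        by simp_all
      ultimately have "level (v 0) = 1" "level (v 1) = 1" "level (v 2) = 1"
        by linarith+
      moreover have "l = 0 \<or> l = 1 \<or> l = 2" if "l \<le> 2" for l :: nat
        using that by auto
      ultimately have "level (v l) = 1" if "l \<le> 2" for l
        using that by metis
      then show ?thesis
        using prod_F_eq_0_dim_2[OF 1(1)] 1(1) by simp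
    next
      case 2
      have "(\<Sum>l=0..3. level (v l)) < 6"
        using assms(3) 2 alpha_discrete[OF assms(2)] by simp
      moreover have "1 \<le> level (v l)" if "l \<le> 3" for l
        using pos[of l] that 2 alpha_discrete[OF assms(2)] by simp
      ultimately show ?thesis
        using prod_F_eq_0_dim_3_discrete[OF 2(1)] 2(1) by simp
    next
      case 3
      \<comment> \<open>Four values that are at least 1 and add up to less than 5 are all equal to
        1.\<close>
      have "alpha P (v 0) + alpha P (v 1) + alpha P (v 2) + alpha P (v 3) < 5"
        using assms(3) 3 by (simp add: numeral_eq_Suc)
      moreover have "1 \<le> alpha P (v 0)" "1 \<le> alpha P (v 1)" "1 \<le> alpha P (v 2)" "1 \<le> alpha P (v 3)"
        by (rule pos; simp add: 3(1))+
      ultimately have "alpha P (v 0) = 1" "alpha P (v 1) = 1" "alpha P (v 2) = 1" "alpha P (v 3) = 1"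
        by linarith+
      moreover have "l = 0 \<or> l = 1 \<or> l = 2 \<or> l = 3" if "l \<le> 3" for l :: nat
        using that by auto
      ultimately have "alpha P (v l) = 1" if "l \<le> 3" for l
        using that by metis
      then show ?thesis
        using prod_F_eq_0_dim_3_two_blocks[OF 3(1) assms(2) 3(2)] 3(1) by simp
    qed
  qed
  then show ?thesis
    by (simp only: ldeg_0)
qed

end
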